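(* Let $G$ be an arbitrary group acting by isometries on an arbitrary geodesic $\delta$-hyperbolic space $X$. If the limit set $\partial_G X$ consists of exactly two points and the action has a locally finite orbit, then there is an action of $G$ by graph automorphisms on the simplicial line $L$ and a coarse $G$-equivariant quasi-isometric embedding from $L$ to $X$.
   Context: The simplicial line $L$ is the graph with vertex set $\mathbb{Z}$ and edges joining consecutive integers, with its path metric (so isometric to $\mathbb{R}$). The action on $X$ has a locally finite orbit if there is $x_0\in X$ such that for all $R\ge 0$ the set $\{g(x_0) : g\in G,\ d(g(x_0),x_0)\le R\}$ is finite. The limit set $\partial_G X$ is the set of accumulation points in the Gromov boundary $\partial X$ of a $G$-orbit. If $G$ acts by isometries on metric spaces $Y$ and $X$, a map $F:Y\to X$ is coarse $G$-equivariant if there is $M\ge 0$ with $d_X(F(g(y)),g(F(y)))\le M$ for all $y\in Y$, $g\in G$. *)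

theory Defs
  imports "HOL-Analysis.Analysis" "HOL-Algebra.Group_Action"
begin

section \<open>Geodesic hyperbolic spaces\<close>

definition geodesic_segment :: "'x::metric_space set \<Rightarrow> 'x \<Rightarrow> 'x \<Rightarrow> bool" where
  "geodesic_segment S x y \<longleftrightarrow>
     (\<exists>c. c 0 = x \<and> c (dist x y) = y \<and> S = c ` {0..dist x y} \<and>
          (\<forall>s\<in>{0..dist x y}. \<forall>t\<in>{0..dist x y}. dist (c s) (c t) = \<bar>s - t\<bar>))"

definition geodesic_space :: "'x::metric_space itself \<Rightarrow> bool" where
  "geodesic_space _ \<longleftrightarrow> (\<forall>x y :: 'x. \<exists>S. geodesic_segment S x y)"

text \<open>Rips' condition: geodesic triangles are \<open>\<delta>\<close>-slim. Quantifying over all vertices and sides,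
  it suffices to mention one side.\<close>

definition hyperbolic_space :: "real \<Rightarrow> 'x::metric_space itself \<Rightarrow> bool" where
  "hyperbolic_space \<delta> _ \<longleftrightarrow>
     (\<forall>(x::'x) y z A B C.
        geodesic_segment A x y \<and> geodesic_segment B y z \<and> geodesic_segment C z x \<longrightarrow>
        (\<forall>a\<in>A. \<exists>b\<in>B \<union> C. dist a b \<le> \<delta>))"


section \<open>The Gromov boundary and the bordification\<close>

text \<open>The base point is called \<open>p\<close> throughout. A change of base point alters the Gromov product
  by a bounded amount only, so none of the boundary, the topology below and the limit set
  depends on it.\<close>

definition gromov_product :: "'x::metric_space \<Rightarrow> 'x \<Rightarrow> 'x \<Rightarrow> real" where
  "gromov_product p x y = (dist p x + dist p y - dist x y) / 2"

definition divergent_pair :: "'x::metric_space \<Rightarrow> (nat \<Rightarrow> 'x) \<Rightarrow> (nat \<Rightarrow> 'x) \<Rightarrow> bool" where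
  "divergent_pair p u v \<longleftrightarrow>
     filterlim (\<lambda>(i, j). gromov_product p (u i) (v j)) at_top (sequentially \<times>\<^sub>F sequentially)"

definition converges_to_infinity :: "'x::metric_space \<Rightarrow> (nat \<Rightarrow> 'x) \<Rightarrow> bool" where
  "converges_to_infinity p u \<longleftrightarrow> divergent_pair p u u"

definition gromov_boundary :: "'x::metric_space \<Rightarrow> (nat \<Rightarrow> 'x) set set" where
  "gromov_boundary p =
     {u. converges_to_infinity p u} //
     {(u, v). converges_to_infinity p u \<and> converges_to_infinity p v \<and> divergent_pair p u v}"

text \<open>The bordification \<open>X \<union> \<partial>X\<close> is a subset of the sum type: \<open>Inl\<close> marks points of the space
  and \<open>Inr\<close> marks boundary points.\<close>

definition gromov_bordification :: "'x::metric_space \<Rightarrow> ('x + (nat \<Rightarrow> 'x) set) set" where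
  "gromov_bordification p = range Inl \<union> Inr ` gromov_boundary p"

fun representatives :: "'x + (nat \<Rightarrow> 'x) set \<Rightarrow> (nat \<Rightarrow> 'x) set" where
  "representatives (Inl x) = {\<lambda>_. x}"
| "representatives (Inr \<xi>) = \<xi>"

text \<open>The usual extension
  \<open>(a | b)\<^sub>p = inf liminf\<^bsub>i,j\<^esub> (u\<^sub>i | v\<^sub>j)\<^sub>p\<close> over the sequences \<open>u\<close>, \<open>v\<close> representing \<open>a\<close>, \<open>b\<close>.\<close>

definition ext_gromov_product ::
    "'x::metric_space \<Rightarrow> 'x + (nat \<Rightarrow> 'x) set \<Rightarrow> 'x + (nat \<Rightarrow> 'x) set \<Rightarrow> ereal" where
  "ext_gromov_product p a b =
     (INF (u, v) \<in> representatives a \<times> representatives b.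
        Liminf (sequentially \<times>\<^sub>F sequentially) (\<lambda>(i, j). ereal (gromov_product p (u i) (v j))))"

definition gromov_nbhd ::
    "'x::metric_space \<Rightarrow> (nat \<Rightarrow> 'x) set \<Rightarrow> real \<Rightarrow> ('x + (nat \<Rightarrow> 'x) set) set" where
  "gromov_nbhd p \<xi> r = {b \<in> gromov_bordification p. ext_gromov_product p (Inr \<xi>) b > ereal r}"

definition gromov_open :: "'x::metric_space \<Rightarrow> ('x + (nat \<Rightarrow> 'x) set) set \<Rightarrow> bool" where
  "gromov_open p U \<longleftrightarrow>
     U \<subseteq> gromov_bordification p \<and> open (Inl -` U) \<and>
     (\<forall>\<xi>. Inr \<xi> \<in> U \<longrightarrow> (\<exists>r. gromov_nbhd p \<xi> r \<subseteq> U))"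

definition gromov_topology :: "'x::metric_space \<Rightarrow> ('x + (nat \<Rightarrow> 'x) set) topology" where
  "gromov_topology p = topology (gromov_open p)"

lemma istopology_gromov_open: "istopology (gromov_open p)"
  unfolding istopology_def
proof (intro conjI allI impI)
  fix S T assume S: "gromov_open p S" and T: "gromov_open p T"
  have "\<exists>r. gromov_nbhd p \<xi> r \<subseteq> S \<inter> T" if mem: "Inr \<xi> \<in> S \<inter> T" for \<xi>
  proof -
    obtain r s where "gromov_nbhd p \<xi> r \<subseteq> S" "gromov_nbhd p \<xi> s \<subseteq> T"
      using S T mem unfolding gromov_open_def by blast
    moreover have "gromov_nbhd p \<xi> (max r s) \<subseteq> gromov_nbhd p \<xi> r \<inter> gromov_nbhd p \<xi> s"
      unfolding gromov_nbhd_def by auto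
    ultimately show ?thesis by blast
  qed
  with S T show "gromov_open p (S \<inter> T)"
    unfolding gromov_open_def by (auto simp: vimage_Int)
next
  fix \<K> assume "\<forall>K\<in>\<K>. gromov_open p K"
  then show "gromov_open p (\<Union>\<K>)"
    unfolding gromov_open_def vimage_Union by (auto intro!: open_UN) (meson Union_upper order_trans)
qed

lemma openin_gromov_topology: "openin (gromov_topology p) U \<longleftrightarrow> gromov_open p U"
  by (simp add: gromov_topology_def istopology_gromov_open topology_inverse')

lemma topspace_gromov_topology: "topspace (gromov_topology p) = gromov_bordification p"
proof -
  have "gromov_open p (gromov_bordification p)"
    by (auto simp: gromov_open_def gromov_bordification_def gromov_nbhd_def vimage_def)
  then show ?thesis
    unfolding topspace_def openin_gromov_topology by (auto simp: gromov_open_def)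
qed


section \<open>Isometric actions\<close>

definition isometric_action ::
    "('g, 'm) monoid_scheme \<Rightarrow> ('g \<Rightarrow> 'x \<Rightarrow> 'x::metric_space) \<Rightarrow> bool" where
  "isometric_action G \<phi> \<longleftrightarrow>
     group_action G UNIV \<phi> \<and> (\<forall>g\<in>carrier G. \<forall>x y. dist (\<phi> g x) (\<phi> g y) = dist x y)"

definition limit_set ::
    "'x::metric_space \<Rightarrow> ('g, 'm) monoid_scheme \<Rightarrow> ('g \<Rightarrow> 'x \<Rightarrow> 'x) \<Rightarrow> 'x \<Rightarrow> (nat \<Rightarrow> 'x) set set" where
  "limit_set p G \<phi> x =
     {\<xi> \<in> gromov_boundary p. Inr \<xi> \<in> gromov_topology p derived_set_of (Inl ` orbit G \<phi> x)}"

definition has_locally_finite_orbit ::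
    "('g, 'm) monoid_scheme \<Rightarrow> ('g \<Rightarrow> 'x \<Rightarrow> 'x::metric_space) \<Rightarrow> bool" where
  "has_locally_finite_orbit G \<phi> \<longleftrightarrow>
     (\<exists>x\<^sub>0. \<forall>R\<ge>0. finite {y \<in> orbit G \<phi> x\<^sub>0. dist y x\<^sub>0 \<le> R})"

definition quasi_isometric_embedding :: "('y::metric_space \<Rightarrow> 'x::metric_space) \<Rightarrow> bool" where
  "quasi_isometric_embedding F \<longleftrightarrow>
     (\<exists>K\<ge>1. \<exists>C\<ge>0. \<forall>s t. dist s t / K - C \<le> dist (F s) (F t) \<and> dist (F s) (F t) \<le> K * dist s t + C)"

definition coarse_equivariant ::
    "('g, 'm) monoid_scheme \<Rightarrow> ('g \<Rightarrow> 'y \<Rightarrow> 'y) \<Rightarrow> ('g \<Rightarrow> 'x \<Rightarrow> 'x) \<Rightarrow>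
     ('y::metric_space \<Rightarrow> 'x::metric_space) \<Rightarrow> bool" where
  "coarse_equivariant G \<psi> \<phi> F \<longleftrightarrow>
     (\<exists>M\<ge>0. \<forall>y. \<forall>g\<in>carrier G. dist (F (\<psi> g y)) (\<phi> g (F y)) \<le> M)"


section \<open>The simplicial line\<close>

text \<open>Combinatorially the simplicial line has vertex type \<^typ>\<open>int\<close>. As a metric space (edges
  included, with the path metric) it is \<^typ>\<open>real\<close>, the edge from \<open>n\<close> to \<open>n + 1\<close> being the
  unit interval between these integers.\<close>

definition line_adjacent :: "int \<Rightarrow> int \<Rightarrow> bool" where
  "line_adjacent m n \<longleftrightarrow> \<bar>m - n\<bar> = 1"

definition line_automorphism :: "(int \<Rightarrow> int) \<Rightarrow> bool" where
  "line_automorphism a \<longleftrightarrow>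
     bij a \<and> (\<forall>m n. line_adjacent (a m) (a n) \<longleftrightarrow> line_adjacent m n)"

text \<open>The map induced on the metric line by a vertex map, affine on each edge.\<close>

definition line_realization :: "(int \<Rightarrow> int) \<Rightarrow> real \<Rightarrow> real" where
  "line_realization a t =
     (1 - frac t) * real_of_int (a \<lfloor>t\<rfloor>) + frac t * real_of_int (a (\<lfloor>t\<rfloor> + 1))"

end

theory Submission
  imports Defs
begin

text \<open>
  Every group element permutes the two limit points.  Hence all points of the locally finite
  orbit lie within bounded distance of a line joining these points, and a Busemann function
  \<open>h\<close> embeds the orbit into \<open>\<real>\<close> up to an additive error.  Each group element then acts on
  heights, up to a bounded error, by a translation or a reflection.

  Local finiteness turns this coarse action into an honest one.  Each \<open>g\<close> moves the ray
  \<open>A = {y. h y \<ge> h x\<^sub>0}\<close> of the orbit to a set \<open>g\<cdot>A\<close> commensurable to \<open>A\<close> (after taking the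
  complement if \<open>g\<close> reverses the line), and the relative index \<open>|g\<cdot>A - A| - |A - g\<cdot>A|\<close> is a
  cocycle with values in \<open>\<int>\<close>.  It defines the action on the line.  Counting orbit points between
  two heights compares it with the action on \<open>X\<close>; a translation in the group shows that the orbit
  has bounded gaps, so that the count is comparable to the distance.
\<close>

subsection \<open>The four-point inequality\<close>

lemma gromov_product_commute: "gromov_product p x y = gromov_product p y x"
  by (simp add: gromov_product_def dist_commute)

lemma gromov_product_base_change: "gromov_product q x y \<le> gromov_product p x y + dist p q"
  using dist_triangle[of q x p] dist_triangle[of q y p]
  unfolding gromov_product_def by (simp add: dist_commute field_simps)

lemma gromov_product_diff_le: "gromov_product p x y \<le> gromov_product p x z + dist y z"
  using dist_triangle[of p y z] dist_triangle[of x z y]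
  unfolding gromov_product_def by (simp add: dist_commute field_simps)

lemma geodesic_segment_commute:
  assumes "geodesic_segment S x y"
  shows "geodesic_segment S y x"
proof -
  obtain c where c: "c 0 = x" "c (dist x y) = y" "S = c ` {0..dist x y}"
     "\<And>s t. s \<in> {0..dist x y} \<Longrightarrow> t \<in> {0..dist x y} \<Longrightarrow> dist (c s) (c t) = \<bar>s - t\<bar>"
    using assms unfolding geodesic_segment_def by blast
  define c' where "c' = (\<lambda>s. c (dist x y - s))"
  have "c' ` {0..dist y x} = c ` {0..dist x y}"
  proof -
    have "(\<lambda>s. dist x y - s) ` {0..dist x y} = {0..dist x y}"
      by (auto simp: image_def intro!: bexI[of _ "dist x y - _"])
    then show ?thesis
      unfolding c'_def by (metis dist_commute image_image)
  qed
  moreover have "dist (c' s) (c' t) = \<bar>s - t\<bar>" if "s \<in> {0..dist y x}" "t \<in> {0..dist y x}" for s t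
    using that c(4)[of "dist x y - s" "dist x y - t"] unfolding c'_def
    by (auto simp: dist_commute)
  ultimately show ?thesis
    using c unfolding geodesic_segment_def
    by (intro exI[of _ c']) (auto simp: c'_def dist_commute)
qed

lemma geodesic_segment_dist_add:
  assumes "geodesic_segment S x y" "q \<in> S"
  shows "dist x q + dist q y = dist x y"
proof -
  obtain c where c: "c 0 = x" "c (dist x y) = y" "S = c ` {0..dist x y}"
     "\<And>s t. s \<in> {0..dist x y} \<Longrightarrow> t \<in> {0..dist x y} \<Longrightarrow> dist (c s) (c t) = \<bar>s - t\<bar>"
    using assms unfolding geodesic_segment_def by blast
  obtain s where s: "s \<in> {0..dist x y}" "q = c s"
    using c(3) assms(2) by blast
  show ?thesis
    using c(4)[of 0 s] c(4)[of s "dist x y"] s c(1,2) by simp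
qed

lemma geodesic_segment_end: "geodesic_segment S x y \<Longrightarrow> x \<in> S" "geodesic_segment S x y \<Longrightarrow> y \<in> S"
  unfolding geodesic_segment_def by (auto simp: image_def intro: bexI[of _ 0] bexI[of _ "dist x y"])

lemma geodesic_segment_compact_connected:
  assumes "geodesic_segment S x y"
  shows "compact S" "connected S"
proof -
  obtain c where c: "S = c ` {0..dist x y}"
     "\<And>s t. s \<in> {0..dist x y} \<Longrightarrow> t \<in> {0..dist x y} \<Longrightarrow> dist (c s) (c t) = \<bar>s - t\<bar>"
    using assms unfolding geodesic_segment_def by blast
  have "continuous_on {0..dist x y} c"
    unfolding continuous_on_iff using c(2) by (auto simp: dist_real_def)
  then show "compact S" "connected S"
    unfolding c(1) by (auto intro: compact_continuous_image connected_continuous_image)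
qed

lemma gromov_product_le_dist:
  assumes "geodesic_segment S x y" "q \<in> S"
  shows "gromov_product w x y \<le> dist w q"
  using geodesic_segment_dist_add[OF assms] dist_triangle[of w x q] dist_triangle[of w y q]
  unfolding gromov_product_def by (simp add: dist_commute)

text \<open>The point is found where the two parts of the side that are close to the other two sides
  meet, by connectedness.\<close>

lemma exists_dist_le_gromov_product:
  fixes x y w :: "'x::metric_space"
  assumes geo: "geodesic_space TYPE('x)" and hyp: "hyperbolic_space \<delta> TYPE('x)"
    and S: "geodesic_segment S x y"
  shows "\<exists>q\<in>S. dist w q \<le> gromov_product w x y + 2 * \<delta>"
proof -
  obtain A B where A: "geodesic_segment A x w" and B: "geodesic_segment B w y"
    using geo unfolding geodesic_space_def by blast
  have slim: "\<exists>b\<in>A \<union> B. dist q b \<le> \<delta>" if "q \<in> S" for q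
    using hyp S geodesic_segment_commute[OF A] geodesic_segment_commute[OF B] that
    unfolding hyperbolic_space_def by (metis Un_commute)
  have \<delta>: "\<delta> \<ge> 0"
    using slim[OF geodesic_segment_end(1)[OF S]] zero_le_dist order_trans by blast
  \<comment> \<open>Measuring closeness by \<open>infdist\<close> makes both pieces closed, as the
    connectedness argument requires; compactness of the sides then recovers actual nearby
    points.\<close>
  define near where "near T = S \<inter> {q. infdist q T \<le> \<delta>}" for T
  have closed: "closed (near T)" for T
    unfolding near_def
    by (intro closed_Int compact_imp_closed geodesic_segment_compact_connected[OF S]
        closed_Collect_le continuous_intros)
  have attained: "\<exists>b\<in>T. dist q b \<le> \<delta>" if "q \<in> near T" "geodesic_segment T a b" for T a b q
  proof -
    have "compact T" "T \<noteq> {}"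
      using geodesic_segment_compact_connected geodesic_segment_end that by blast+
    then obtain b where b: "b \<in> T" "\<And>b'. b' \<in> T \<Longrightarrow> dist q b \<le> dist q b'"
      using continuous_attains_inf[of T "\<lambda>b. dist q b"] continuous_on_dist[OF continuous_on_const continuous_on_id]
      by blast
    then have "dist q b \<le> infdist q T"
      using \<open>T \<noteq> {}\<close> by (simp add: infdist_notempty cINF_greatest)
    then show ?thesis using that b(1) unfolding near_def by force
  qed
  have "S \<subseteq> near A \<union> near B"
  proof
    fix q assume q: "q \<in> S"
    then obtain b where b: "b \<in> A \<union> B" "dist q b \<le> \<delta>" using slim by blast
    then have "b \<in> A \<and> infdist q A \<le> \<delta> \<or> b \<in> B \<and> infdist q B \<le> \<delta>"
      using infdist_le2 by blast
    then show "q \<in> near A \<union> near B" using q unfolding near_def by auto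
  qed
  moreover have "x \<in> near A" "y \<in> near B"
    using geodesic_segment_end[OF S] geodesic_segment_end[OF A] geodesic_segment_end[OF B] \<delta>
    unfolding near_def by auto
  ultimately obtain q where q: "q \<in> near A" "q \<in> near B" "q \<in> S"
    using connected_closedD[OF geodesic_segment_compact_connected(2)[OF S], of "near A" "near B"]
      closed unfolding near_def by blast
  obtain a b where a: "a \<in> A" "dist q a \<le> \<delta>" and b: "b \<in> B" "dist q b \<le> \<delta>"
    using attained A B q by blast
  have "dist x a + dist a w = dist x w" "dist w b + dist b y = dist w y" "dist x q + dist q y = dist x y"
    using geodesic_segment_dist_add A B S a b q by blast+
  moreover have "dist x q \<le> dist x a + dist q a" "dist q y \<le> dist q b + dist b y"
    "dist w q \<le> dist a w + dist q a" "dist w q \<le> dist w b + dist q b"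
    by (metis dist_triangle dist_commute add.commute)+
  \<comment> \<open>The average of the two bounds on \<open>dist w q\<close>: passing from
    \<open>q\<close> to \<open>a\<close> and to \<open>b\<close> costs \<delta> along
    \<open>S\<close> and again towards \<open>w\<close>, hence \<open>4 * \<delta>\<close> before
    halving.\<close>
  ultimately have "dist w q \<le> gromov_product w x y + 2 * \<delta>"
    using a b unfolding gromov_product_def dist_commute[of y w] dist_commute[of x w]
    by (simp add: dist_commute[of w x] field_simps)
  then show ?thesis using q by blast
qed

text \<open>A point of the side from \<open>x\<close> to \<open>z\<close> realises the product up to
  \<open>2 * \<delta>\<close>, and slimness puts a point of another side within \<delta> of it.
  Points of a side are at least as far from \<open>w\<close> as the product of its ends.\<close>

lemma gromov_product_hyperbolic:
  fixes x y z w :: "'x::metric_space"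
  assumes geo: "geodesic_space TYPE('x)" and hyp: "hyperbolic_space \<delta> TYPE('x)"
  shows "min (gromov_product w x y) (gromov_product w y z) \<le> gromov_product w x z + 3 * \<delta>"
proof -
  obtain S A B where S: "geodesic_segment S x z" and A: "geodesic_segment A x y"
    and B: "geodesic_segment B y z"
    using geo unfolding geodesic_space_def by blast
  obtain q where q: "q \<in> S" "dist w q \<le> gromov_product w x z + 2 * \<delta>"
    using exists_dist_le_gromov_product[OF geo hyp S] by blast
  obtain b where b: "b \<in> A \<union> B" "dist q b \<le> \<delta>"
    using hyp S geodesic_segment_commute[OF A] geodesic_segment_commute[OF B] q(1)
    unfolding hyperbolic_space_def by (metis Un_commute)
  have "min (gromov_product w x y) (gromov_product w y z) \<le> dist w b"
    using b(1) gromov_product_le_dist[OF A, of b w] gromov_product_le_dist[OF B, of b w] by auto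
  also have "\<dots> \<le> dist w q + dist q b" by (rule dist_triangle)
  finally show ?thesis using q b by simp
qed

subsection \<open>Limit sets as sets of classes of orbit sequences\<close>

lemma divergent_pair_iff:
  "divergent_pair p u v \<longleftrightarrow> (\<forall>R. \<exists>N. \<forall>i\<ge>N. \<forall>j\<ge>N. R \<le> gromov_product p (u i) (v j))"
  unfolding divergent_pair_def filterlim_at_top eventually_prod_sequentially prod.case by meson

lemma divergent_pair_commute: "divergent_pair p u v \<longleftrightarrow> divergent_pair p v u"
  unfolding divergent_pair_iff by (metis gromov_product_commute)

lemma divergent_pair_base_change:
  assumes "divergent_pair p u v"
  shows "divergent_pair q u v"
  unfolding divergent_pair_iff
proof
  fix R
  obtain N where N: "\<forall>i\<ge>N. \<forall>j\<ge>N. R + dist p q \<le> gromov_product p (u i) (v j)"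
    using assms unfolding divergent_pair_iff by blast
  have "R \<le> gromov_product q (u i) (v j)" if "i \<ge> N" "j \<ge> N" for i j
  proof -
    have "R + dist p q \<le> gromov_product p (u i) (v j)" using N that by blast
    then show ?thesis
      using gromov_product_base_change[of p "u i" "v j" q] by (simp add: dist_commute)
  qed
  then show "\<exists>N. \<forall>i\<ge>N. \<forall>j\<ge>N. R \<le> gromov_product q (u i) (v j)" by blast
qed

lemma divergent_pairD:
  "divergent_pair p u v \<Longrightarrow> \<exists>N. \<forall>i\<ge>N. \<forall>j\<ge>N. R \<le> gromov_product q (u i) (v j)"
  using divergent_pair_base_change divergent_pair_iff by blast

lemma less_ext_gromov_productD:
  assumes "ereal r < ext_gromov_product p a b" "u \<in> representatives a" "v \<in> representatives b"
  shows "\<exists>N. \<forall>i\<ge>N. \<forall>j\<ge>N. r < gromov_product p (u i) (v j)"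
proof -
  have "ereal r < Liminf (sequentially \<times>\<^sub>F sequentially) (\<lambda>(i, j). ereal (gromov_product p (u i) (v j)))"
    using less_INF_D[OF assms(1)[unfolded ext_gromov_product_def], of "(u, v)"] assms(2,3) by simp
  from less_LiminfD[OF this] show ?thesis
    unfolding eventually_prod_sequentially by auto
qed

lemma less_ext_gromov_product_InlD:
  assumes "ereal r < ext_gromov_product p a (Inl y)" "u \<in> representatives a"
  shows "\<exists>N. \<forall>i\<ge>N. r < gromov_product p (u i) y"
  using less_ext_gromov_productD[OF assms, of "\<lambda>_. y"] by auto

lemma ext_gromov_product_ge:
  assumes "\<And>u v. u \<in> representatives a \<Longrightarrow> v \<in> representatives b \<Longrightarrow>
    \<exists>N. \<forall>i\<ge>N. \<forall>j\<ge>N. r \<le> gromov_product p (u i) (v j)"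
  shows "ereal r \<le> ext_gromov_product p a b"
  unfolding ext_gromov_product_def
proof (rule INF_greatest, clarify)
  fix u v assume "u \<in> representatives a" "v \<in> representatives b"
  from assms[OF this]
  show "ereal r \<le> Liminf (sequentially \<times>\<^sub>F sequentially) (\<lambda>(i, j). ereal (gromov_product p (u i) (v j)))"
    by (intro Liminf_bounded) (auto simp: eventually_prod_sequentially)
qed

text \<open>Hyperbolicity now enters only through this inequality. It is assumed at every
  \<open>w\<close>, because later estimates are based at moving orbit points, while \<open>p\<close>
  stays the base point of the boundary.\<close>

locale four_point_space =
  fixes p :: "'x::metric_space" and D :: real
  assumes four_point: "\<And>w x y z :: 'x.
    min (gromov_product w x y) (gromov_product w y z) \<le> gromov_product w x z + D"
begin

lemma gromov_product_ge:
  "r \<le> gromov_product w x y \<Longrightarrow> r \<le> gromov_product w y z \<Longrightarrow> r - D \<le> gromov_product w x z"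
  for w x y z :: 'x
  using four_point[of w x y z] by linarith

lemma divergent_pair_trans:
  assumes "divergent_pair p u v" "divergent_pair p v w"
  shows "divergent_pair p u w"
  unfolding divergent_pair_iff
proof
  fix R
  obtain N M where N: "\<forall>i\<ge>N. \<forall>j\<ge>N. R + D \<le> gromov_product p (u i) (v j)"
    and M: "\<forall>i\<ge>M. \<forall>j\<ge>M. R + D \<le> gromov_product p (v i) (w j)"
    using assms unfolding divergent_pair_iff by meson
  have "\<forall>i\<ge>max N M. \<forall>j\<ge>max N M. R \<le> gromov_product p (u i) (w j)"
    using gromov_product_ge[of "R + D" p _ "v (max N M)"] N M by fastforce
  then show "\<exists>N. \<forall>i\<ge>N. \<forall>j\<ge>N. R \<le> gromov_product p (u i) (w j)" by blast
qed

lemma converges_to_infinity_if_divergent_pair: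
  "divergent_pair p u v \<Longrightarrow> converges_to_infinity p u"
  unfolding converges_to_infinity_def
  using divergent_pair_trans divergent_pair_commute by blast

lemma equiv_divergent_pair:
  "equiv {u. converges_to_infinity p u}
    {(u, v). converges_to_infinity p u \<and> converges_to_infinity p v \<and> divergent_pair p u v}"
  by (intro equivI refl_onI symI transI)
    (auto simp: converges_to_infinity_def divergent_pair_commute intro: divergent_pair_trans)

lemma gromov_boundary_eq_class:
  assumes "\<xi> \<in> gromov_boundary p" "u \<in> \<xi>"
  shows "\<xi> = {v. divergent_pair p u v}"
proof -
  obtain u' where u': "converges_to_infinity p u'"
    "\<xi> = {v. converges_to_infinity p v \<and> divergent_pair p u' v}"
    using assms(1) unfolding gromov_boundary_def by (auto elim!: quotientE)
  then have "\<xi> = {v. divergent_pair p u' v}"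
    using converges_to_infinity_if_divergent_pair divergent_pair_commute by blast
  moreover have "divergent_pair p u' v \<longleftrightarrow> divergent_pair p u v" for v
    using u' assms(2) divergent_pair_trans[of u u' v] divergent_pair_trans[of u' u v]
    by (auto simp: divergent_pair_commute)
  ultimately show ?thesis by simp
qed

lemma class_in_gromov_boundary:
  assumes "converges_to_infinity p u"
  shows "{v. divergent_pair p u v} \<in> gromov_boundary p" "u \<in> {v. divergent_pair p u v}"
proof -
  have "{(u, v). converges_to_infinity p u \<and> converges_to_infinity p v \<and> divergent_pair p u v} `` {u}
      = {v. divergent_pair p u v}"
    using assms converges_to_infinity_if_divergent_pair divergent_pair_commute by blast
  then show "{v. divergent_pair p u v} \<in> gromov_boundary p"
    using quotientI[of u "{u. converges_to_infinity p u}"] assms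
    unfolding gromov_boundary_def by (metis (no_types, lifting) mem_Collect_eq)
  show "u \<in> {v. divergent_pair p u v}"
    using assms unfolding converges_to_infinity_def by simp
qed

lemma gromov_boundary_nonempty: "\<xi> \<in> gromov_boundary p \<Longrightarrow> \<exists>u. u \<in> \<xi>"
  unfolding gromov_boundary_def using in_quotient_imp_non_empty[OF equiv_divergent_pair] by blast

lemma gromov_boundary_divergent_pair:
  "\<xi> \<in> gromov_boundary p \<Longrightarrow> u \<in> \<xi> \<Longrightarrow> v \<in> \<xi> \<Longrightarrow> divergent_pair p u v"
  using gromov_boundary_eq_class by blast

text \<open>The sets \<^term>\<open>gromov_nbhd p \<xi> r\<close> need not be open, but they are neighbourhoods
  of \<^term>\<open>Inr \<xi>\<close>.\<close>

lemma gromov_nbhd_contains_open: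
  assumes \<xi>: "\<xi> \<in> gromov_boundary p"
  shows "\<exists>U. gromov_open p U \<and> Inr \<xi> \<in> U \<and> Inl -` U \<subseteq> Inl -` gromov_nbhd p \<xi> r"
proof -
  define V where "V = gromov_nbhd p \<xi> r"
  \<comment> \<open>The points of which \<open>V\<close> is a neighbourhood: its metric interior and
    the boundary points with a basic neighbourhood inside \<open>V\<close>.\<close>
  define U where "U = Inl ` interior (Inl -` V) \<union>
    Inr ` {\<eta> \<in> gromov_boundary p. \<exists>s. gromov_nbhd p \<eta> s \<subseteq> V}"
  have "\<exists>s. gromov_nbhd p \<eta> s \<subseteq> U" if "Inr \<eta> \<in> U" for \<eta>
  proof -
    obtain s where \<eta>: "\<eta> \<in> gromov_boundary p" "gromov_nbhd p \<eta> s \<subseteq> V"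
      using \<open>Inr \<eta> \<in> U\<close> unfolding U_def by auto
    \<comment> \<open>One unit absorbs a metric ball of radius 1, one gives a strict bound on an
      infimum, and \<open>s + D\<close> covers the loss in the four-point inequality.\<close>
    define t where "t = max s (s + D) + 2"
    have "b \<in> U" if b: "b \<in> gromov_nbhd p \<eta> t" for b
    proof (cases b)
      case (Inl y)
      have "ball y 1 \<subseteq> Inl -` V"
      proof
        fix y' assume y': "y' \<in> ball y 1"
        have "ereal (s + 1) \<le> ext_gromov_product p (Inr \<eta>) (Inl y')"
        proof (rule ext_gromov_product_ge)
          fix u v assume uv: "u \<in> representatives (Inr \<eta>)" "v \<in> representatives (Inl y')"
          obtain N where N: "\<forall>i\<ge>N. t < gromov_product p (u i) y"
            using less_ext_gromov_product_InlD[of t p "Inr \<eta>" y u] b uv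
            unfolding Inl gromov_nbhd_def by auto
          have "s + 1 \<le> gromov_product p (u i) y'" if "i \<ge> N" for i
          proof -
            have "t < gromov_product p (u i) y" "dist y y' < 1"
              using N that y' by auto
            then show ?thesis
              using gromov_product_diff_le[of p "u i" y y'] unfolding t_def by linarith
          qed
          then show "\<exists>N. \<forall>i\<ge>N. \<forall>j\<ge>N. s + 1 \<le> gromov_product p (u i) (v j)"
            using uv by auto
        qed
        then have "ereal s < ext_gromov_product p (Inr \<eta>) (Inl y')"
          by (meson ereal_less_le less_add_one less_ereal.simps(1) less_le_trans)
        then show "y' \<in> Inl -` V"
          using \<eta>(2) unfolding gromov_nbhd_def gromov_bordification_def by auto
      qed
      then show ?thesis
        unfolding U_def Inl by (auto intro!: imageI interiorI[of "ball y 1"])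
    next
      case (Inr \<zeta>)
      then have \<zeta>: "\<zeta> \<in> gromov_boundary p" "ereal t < ext_gromov_product p (Inr \<eta>) (Inr \<zeta>)"
        using b unfolding gromov_nbhd_def gromov_bordification_def by auto
      have "gromov_nbhd p \<zeta> t \<subseteq> gromov_nbhd p \<eta> s"
      proof
        fix c assume c: "c \<in> gromov_nbhd p \<zeta> t"
        have "ereal (s + 1) \<le> ext_gromov_product p (Inr \<eta>) c"
        proof (rule ext_gromov_product_ge)
          fix u w assume uw: "u \<in> representatives (Inr \<eta>)" "w \<in> representatives c"
          obtain v where v: "v \<in> \<zeta>" using gromov_boundary_nonempty \<zeta>(1) by blast
          obtain N where N: "\<forall>i\<ge>N. \<forall>j\<ge>N. t < gromov_product p (u i) (v j)"
            using less_ext_gromov_productD[OF \<zeta>(2) uw(1), of v] v by auto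
          obtain M where M: "\<forall>i\<ge>M. \<forall>j\<ge>M. t < gromov_product p (v i) (w j)"
            using less_ext_gromov_productD[of t p "Inr \<zeta>" c v w] c v uw(2) unfolding gromov_nbhd_def by auto
          have "s + 1 \<le> gromov_product p (u i) (w j)" if "i \<ge> max N M" "j \<ge> max N M" for i j
          proof -
            have "t < gromov_product p (u i) (v (max N M))" "t < gromov_product p (v (max N M)) (w j)"
              using N M that by auto
            then show ?thesis
              using gromov_product_ge[of t p "u i" "v (max N M)" "w j"] unfolding t_def by linarith
          qed
          then show "\<exists>N. \<forall>i\<ge>N. \<forall>j\<ge>N. s + 1 \<le> gromov_product p (u i) (w j)" by blast
        qed
        then have "ereal s < ext_gromov_product p (Inr \<eta>) c"
          by (meson ereal_less_le less_add_one less_ereal.simps(1) less_le_trans)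
        then show "c \<in> gromov_nbhd p \<eta> s"
          using c unfolding gromov_nbhd_def by auto
      qed
      then show ?thesis using \<eta> \<zeta> unfolding Inr U_def by blast
    qed
    then show ?thesis by blast
  qed
  moreover have "Inl -` U = interior (Inl -` V)"
    unfolding U_def by auto
  moreover have "U \<subseteq> gromov_bordification p" "Inr \<xi> \<in> U"
    using \<xi> unfolding U_def V_def gromov_bordification_def by auto
  ultimately have "gromov_open p U \<and> Inr \<xi> \<in> U \<and> Inl -` U \<subseteq> Inl -` V"
    unfolding gromov_open_def using interior_subset[of "Inl -` V"] by simp
  then show ?thesis unfolding V_def by blast
qed

text \<open>Orbit points chosen in the neighbourhoods of level \<open>n\<close> form a sequence
  equivalent to any representative of \<xi>.\<close>

lemma limit_set_imp_sequence:
  assumes "\<xi> \<in> limit_set p G \<phi> x"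
  shows "\<exists>u\<in>\<xi>. range u \<subseteq> orbit G \<phi> x"
proof -
  have \<xi>: "\<xi> \<in> gromov_boundary p" "Inr \<xi> \<in> gromov_topology p derived_set_of (Inl ` orbit G \<phi> x)"
    using assms unfolding limit_set_def by auto
  have "\<exists>y\<in>orbit G \<phi> x. Inl y \<in> gromov_nbhd p \<xi> r" for r
  proof -
    obtain U where U: "gromov_open p U" "Inr \<xi> \<in> U" "Inl -` U \<subseteq> Inl -` gromov_nbhd p \<xi> r"
      using gromov_nbhd_contains_open[OF \<xi>(1)] by blast
    then obtain y where "y \<in> orbit G \<phi> x" "Inl y \<in> U"
      using \<xi>(2) unfolding in_derived_set_of openin_gromov_topology by blast
    then show ?thesis using U(3) by blast
  qed
  then have "\<forall>n::nat. \<exists>y. y \<in> orbit G \<phi> x \<and> Inl y \<in> gromov_nbhd p \<xi> (real n)" by blast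
  then obtain y where y: "\<And>n::nat. y n \<in> orbit G \<phi> x" "\<And>n. Inl (y n) \<in> gromov_nbhd p \<xi> (real n)"
    by metis
  obtain w where w: "w \<in> \<xi>" using gromov_boundary_nonempty[OF \<xi>(1)] by blast
  have near: "\<exists>N. \<forall>i\<ge>N. real n < gromov_product p (w i) (y n)" for n
    using less_ext_gromov_product_InlD[of "real n" p "Inr \<xi>" "y n" w] y(2)[of n] w
    unfolding gromov_nbhd_def by auto
  have "divergent_pair p w y"
    unfolding divergent_pair_iff
  proof
    fix R
    obtain N where N: "\<forall>i\<ge>N. \<forall>j\<ge>N. R + D \<le> gromov_product p (w i) (w j)"
      using gromov_boundary_divergent_pair[OF \<xi>(1) w w] unfolding divergent_pair_iff by blast
    obtain M :: nat where M: "real M \<ge> R + D" using real_arch_simple by blast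
    have "R \<le> gromov_product p (w i) (y j)" if "i \<ge> max N M" "j \<ge> max N M" for i j
    proof -
      \<comment> \<open>How late a term of \<open>w\<close> must be to have a large product with
        \<open>y j\<close> depends on \<open>j\<close>, so \<open>w i\<close> and \<open>y j\<close>
        are compared through the later term \<open>w (max N K)\<close>.\<close>
      obtain K where K: "\<forall>k\<ge>K. real j < gromov_product p (w k) (y j)" using near by blast
      have "R + D \<le> gromov_product p (w i) (w (max N K))"
        using N that by simp
      moreover have "real M \<le> real j" "real j \<le> gromov_product p (w (max N K)) (y j)"
        using K that by (auto intro: less_imp_le)
      then have "R + D \<le> gromov_product p (w (max N K)) (y j)"
        using M by linarith
      ultimately show ?thesis using gromov_product_ge by force
    qed
    then show "\<exists>N. \<forall>i\<ge>N. \<forall>j\<ge>N. R \<le> gromov_product p (w i) (y j)" by blast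
  qed
  then have "y \<in> \<xi>"
    using gromov_boundary_eq_class[OF \<xi>(1) w] by blast
  then show ?thesis using y(1) by blast
qed

text \<open>Late terms of \<open>u\<close> enter every neighbourhood of \<open>Inr \<xi>\<close>,
  and they differ from it because they lie in the \<open>Inl\<close> part.\<close>

lemma sequence_imp_limit_set:
  assumes \<xi>: "\<xi> \<in> gromov_boundary p" and u: "u \<in> \<xi>" "range u \<subseteq> orbit G \<phi> x"
  shows "\<xi> \<in> limit_set p G \<phi> x"
proof -
  have "\<exists>y. y \<noteq> Inr \<xi> \<and> y \<in> Inl ` orbit G \<phi> x \<and> y \<in> U" if U: "gromov_open p U" "Inr \<xi> \<in> U" for U
  proof -
    obtain r where r: "gromov_nbhd p \<xi> r \<subseteq> U" using U unfolding gromov_open_def by blast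
    obtain N where N: "\<forall>i\<ge>N. \<forall>j\<ge>N. r + 1 + D \<le> gromov_product p (u i) (u j)"
      using gromov_boundary_divergent_pair[OF \<xi> u(1) u(1)] unfolding divergent_pair_iff by blast
    have "ereal (r + 1) \<le> ext_gromov_product p (Inr \<xi>) (Inl (u N))"
    proof (rule ext_gromov_product_ge)
      fix w v assume wv: "w \<in> representatives (Inr \<xi>)" "v \<in> representatives (Inl (u N))"
      obtain M where M: "\<forall>i\<ge>M. \<forall>j\<ge>M. r + 1 + D \<le> gromov_product p (w i) (u j)"
        using gromov_boundary_divergent_pair[OF \<xi> _ u(1)] wv(1) unfolding divergent_pair_iff by fastforce
      have "r + 1 \<le> gromov_product p (w i) (u N)" if "i \<ge> M" for i
        using gromov_product_ge[of "r + 1 + D" p "w i" "u (max M N)" "u N"] N M that by auto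
      then show "\<exists>N. \<forall>i\<ge>N. \<forall>j\<ge>N. r + 1 \<le> gromov_product p (w i) (v j)"
        using wv(2) by auto
    qed
    then have "ereal r < ext_gromov_product p (Inr \<xi>) (Inl (u N))"
      by (meson ereal_less_le less_add_one less_ereal.simps(1) less_le_trans)
    then have "Inl (u N) \<in> U"
      using r unfolding gromov_nbhd_def gromov_bordification_def by auto
    then show ?thesis using u(2) by blast
  qed
  then show ?thesis
    using \<xi> unfolding limit_set_def in_derived_set_of openin_gromov_topology topspace_gromov_topology
    by (auto simp: gromov_bordification_def)
qed

end

subsection \<open>A height function on the orbit\<close>

lemma isometric_actionD:
  assumes "isometric_action G \<phi>"
  shows "group_action G UNIV \<phi>"
    and "g \<in> carrier G \<Longrightarrow> dist (\<phi> g y) (\<phi> g z) = dist y z"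
  using assms unfolding isometric_action_def by auto

lemma orbit_closed:
  assumes "group_action G UNIV \<phi>" "y \<in> orbit G \<phi> x" "g \<in> carrier G"
  shows "\<phi> g y \<in> orbit G \<phi> x"
proof -
  interpret group_action G UNIV \<phi> by fact
  interpret group G using group_hom group_hom_def by blast
  obtain g' where g': "g' \<in> carrier G" "y = \<phi> g' x"
    using assms(2) unfolding orbit_def by blast
  then have "\<phi> g y = \<phi> (g \<otimes>\<^bsub>G\<^esub> g') x"
    using composition_rule[of x g g'] assms(3) by simp
  then show ?thesis
    using g'(1) assms(3) m_closed unfolding orbit_def by blast
qed

context four_point_space
begin

lemma D_nonneg: "0 \<le> D"
  using four_point[of p p p p] by simp

text \<open>The symmetric form of the inequality, without a base point: the distances to
  \<open>e\<close> are cleared from the Gromov products based there.\<close>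

lemma four_point_dist:
  "dist a b + dist c e \<le> max (dist a c + dist b e) (dist a e + dist b c) + 2 * D" for a b c e :: 'x
  using four_point[of e a c b] unfolding gromov_product_def
  by (simp add: dist_commute min_def max_def field_simps split: if_splits)

text \<open>Failure of divergence gives only arbitrarily late small products. Since the tails of
  \<open>u\<close> and of \<open>v\<close> cluster, a single large late product would make all late
  products large, at the cost of two uses of the four-point inequality.\<close>

lemma gromov_product_bounded_if_not_divergent:
  assumes "converges_to_infinity p u" "converges_to_infinity p v" "\<not> divergent_pair p u v"
  shows "\<exists>R N. \<forall>i\<ge>N. \<forall>j\<ge>N. gromov_product p (u i) (v j) \<le> R"
proof -
  obtain R where R: "\<And>N. \<exists>i\<ge>N. \<exists>j\<ge>N. gromov_product p (u i) (v j) < R"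
    using assms(3) unfolding divergent_pair_iff by (meson not_le)
  obtain N M where N: "\<forall>i\<ge>N. \<forall>j\<ge>N. R + 2 * D \<le> gromov_product p (u i) (u j)"
    and M: "\<forall>i\<ge>M. \<forall>j\<ge>M. R + 2 * D \<le> gromov_product p (v i) (v j)"
    using assms(1,2)[unfolded converges_to_infinity_def, THEN divergent_pairD] by blast
  obtain k l where kl: "k \<ge> max N M" "l \<ge> max N M" "gromov_product p (u k) (v l) < R"
    using R by blast
  have "gromov_product p (u i) (v j) \<le> R + 2 * D" if ij: "i \<ge> max N M" "j \<ge> max N M" for i j
  proof (rule ccontr)
    assume "\<not> ?thesis"
    then have "R + 2 * D \<le> gromov_product p (u i) (v j)" by simp
    moreover have "R + 2 * D \<le> gromov_product p (u k) (u i)" "R + 2 * D \<le> gromov_product p (v j) (v l)"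
      using N M ij kl by auto
    ultimately have "R + 2 * D - D - D \<le> gromov_product p (u k) (v l)"
      using gromov_product_ge[of "R + 2 * D" p "u k" "u i" "v j"]
        gromov_product_ge[of "R + 2 * D - D" p "u k" "v j" "v l"] D_nonneg by auto
    then show False using kl(3) by simp
  qed
  then show ?thesis by blast
qed

text \<open>The chain from \<open>a k\<close> through \<open>u i\<close> and \<open>v j\<close> to
  \<open>b k\<close> has large outer links, so a large middle link would force a large product of
  \<open>a k\<close> and \<open>b k\<close>.\<close>

lemma gromov_product_bounded_transfer:
  assumes "divergent_pair p a u" "divergent_pair p b v"
    and R: "\<And>k. k \<ge> K \<Longrightarrow> gromov_product y (a k) (b k) \<le> R"
  shows "\<exists>N. \<forall>i\<ge>N. \<forall>j\<ge>N. gromov_product y (u i) (v j) \<le> R + 2 * D"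
proof -
  obtain N M where N: "\<forall>i\<ge>N. \<forall>j\<ge>N. R + 2 * D + 1 \<le> gromov_product y (a i) (u j)"
    and M: "\<forall>i\<ge>M. \<forall>j\<ge>M. R + 2 * D + 1 \<le> gromov_product y (b i) (v j)"
    using assms(1,2)[THEN divergent_pairD] by blast
  define k where "k = max K (max N M)"
  have "gromov_product y (u i) (v j) \<le> R + 2 * D" if ij: "i \<ge> k" "j \<ge> k" for i j
  proof (rule ccontr)
    assume neg: "\<not> ?thesis"
    define r where "r = min (R + 2 * D + 1) (gromov_product y (u i) (v j))"
    have r: "R + 2 * D < r" using neg unfolding r_def by auto
    have "R + 2 * D + 1 \<le> gromov_product y (a k) (u i)" "R + 2 * D + 1 \<le> gromov_product y (b k) (v j)"
      using N M ij unfolding k_def by simp_all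
    then have "r \<le> gromov_product y (a k) (u i)" "r \<le> gromov_product y (u i) (v j)"
      "r \<le> gromov_product y (v j) (b k)"
      unfolding r_def gromov_product_commute[of y "v j" "b k"] by simp_all
    then have "r - D - D \<le> gromov_product y (a k) (b k)"
      using gromov_product_ge[of r y "a k" "u i" "v j"]
        gromov_product_ge[of "r - D" y "a k" "v j" "b k"] D_nonneg by auto
    also have "\<dots> \<le> R" using R unfolding k_def by simp
    finally show False using r by simp
  qed
  then show ?thesis by blast
qed

text \<open>The isometry moves the base point to \<open>f p\<close>, which a change of base
  undoes.\<close>

lemma divergent_pair_isometry:
  assumes "\<And>y z. dist (f y) (f z) = dist y z"
  shows "divergent_pair p (f \<circ> u) (f \<circ> v) \<longleftrightarrow> divergent_pair p u v"
proof -
  have "divergent_pair (f p) (f \<circ> u) (f \<circ> v) \<longleftrightarrow> divergent_pair p u v"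
    unfolding divergent_pair_iff gromov_product_def by (simp add: assms)
  then show ?thesis using divergent_pair_base_change by blast
qed

text \<open>An isometry in the group permutes the two limit points, so it moves a pair of sequences
  representing them to a pair representing them in one of the two orders.\<close>

lemma orbit_near_axis:
  assumes act: "isometric_action G \<phi>" and lim: "card (limit_set p G \<phi> x) = 2"
  obtains u v C where "range u \<subseteq> orbit G \<phi> x" "converges_to_infinity p u" "converges_to_infinity p v"
    "\<And>y. y \<in> orbit G \<phi> x\<^sub>0 \<Longrightarrow> \<exists>N. \<forall>i\<ge>N. \<forall>j\<ge>N. gromov_product y (u i) (v j) \<le> C"
proof -
  obtain \<xi> \<eta> where lim': "limit_set p G \<phi> x = {\<xi>, \<eta>}" "\<xi> \<noteq> \<eta>"
    using lim unfolding card_2_iff by (elim exE conjE)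
  have bd: "\<xi> \<in> gromov_boundary p" "\<eta> \<in> gromov_boundary p"
    using lim' unfolding limit_set_def by auto
  obtain u v where u: "u \<in> \<xi>" "range u \<subseteq> orbit G \<phi> x" and v: "v \<in> \<eta>" "range v \<subseteq> orbit G \<phi> x"
    using limit_set_imp_sequence[of \<xi> G \<phi> x] limit_set_imp_sequence[of \<eta> G \<phi> x] lim'(1) by auto
  note \<xi> = gromov_boundary_eq_class[OF bd(1) u(1)] and \<eta> = gromov_boundary_eq_class[OF bd(2) v(1)]
  have not_div: "\<not> divergent_pair p u v"
  proof
    assume "divergent_pair p u v"
    then have "v \<in> \<xi>" using \<xi> by blast
    then have "\<xi> = \<eta>" using gromov_boundary_eq_class[OF bd(1), of v] \<eta> by simp
    then show False using lim' by blast
  qed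
  have conv: "converges_to_infinity p u" "converges_to_infinity p v"
    using gromov_boundary_divergent_pair bd u v unfolding converges_to_infinity_def by blast+
  obtain R N where R: "\<forall>i\<ge>N. \<forall>j\<ge>N. gromov_product p (u i) (v j) \<le> R"
    using gromov_product_bounded_if_not_divergent[OF conv not_div] by blast
  have perm: "divergent_pair p (\<phi> g \<circ> w) u \<or> divergent_pair p (\<phi> g \<circ> w) v"
    if g: "g \<in> carrier G" and w: "converges_to_infinity p w" "range w \<subseteq> orbit G \<phi> x" for g w
  proof -
    \<comment> \<open>The moved sequence stays in the orbit of \<open>x\<close>, so its class is
      again a limit point.\<close>
    define \<zeta> where "\<zeta> = {w'. divergent_pair p (\<phi> g \<circ> w) w'}"
    have "converges_to_infinity p (\<phi> g \<circ> w)"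
      using divergent_pair_isometry[of "\<phi> g"] isometric_actionD(2)[OF act g] w(1)
      unfolding converges_to_infinity_def by blast
    then have \<zeta>: "\<zeta> \<in> gromov_boundary p" "\<phi> g \<circ> w \<in> \<zeta>"
      using class_in_gromov_boundary unfolding \<zeta>_def by blast+
    moreover have "range (\<phi> g \<circ> w) \<subseteq> orbit G \<phi> x"
      using orbit_closed[OF isometric_actionD(1)[OF act] _ g] w(2) by (auto simp: image_subset_iff)
    ultimately have "\<zeta> = \<xi> \<or> \<zeta> = \<eta>"
      using sequence_imp_limit_set[of \<zeta> "\<phi> g \<circ> w" G \<phi> x] lim'(1) by simp
    then have "u \<in> \<zeta> \<or> v \<in> \<zeta>" using u v by blast
    then show ?thesis unfolding \<zeta>_def by blast
  qed
  \<comment> \<open>\<open>R\<close> bounds the products at \<open>p\<close>, the base change to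
    \<open>x\<^sub>0\<close> costs \<open>dist p x\<^sub>0\<close>, and returning from the moved
    sequences to \<open>u\<close> and \<open>v\<close> costs \<open>2 * D\<close>.\<close>
  define C where "C = R + dist p x\<^sub>0 + 2 * D"
  have "\<exists>N. \<forall>i\<ge>N. \<forall>j\<ge>N. gromov_product y (u i) (v j) \<le> C" if y: "y \<in> orbit G \<phi> x\<^sub>0" for y
  proof -
    obtain g where g: "g \<in> carrier G" "y = \<phi> g x\<^sub>0"
      using y unfolding orbit_def by blast
    have iso: "dist (\<phi> g a) (\<phi> g b) = dist a b" for a b
      using isometric_actionD(2)[OF act g(1)] .
    have bound: "gromov_product y ((\<phi> g \<circ> u) k) ((\<phi> g \<circ> v) k) \<le> R + dist p x\<^sub>0" if "k \<ge> N" for k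
    proof -
      have "gromov_product y ((\<phi> g \<circ> u) k) ((\<phi> g \<circ> v) k) = gromov_product x\<^sub>0 (u k) (v k)"
        unfolding gromov_product_def g by (simp add: iso)
      also have "\<dots> \<le> gromov_product p (u k) (v k) + dist p x\<^sub>0"
        by (rule gromov_product_base_change)
      finally show ?thesis using R that by fastforce
    qed
    \<comment> \<open>The images of \<open>u\<close> and \<open>v\<close> cannot represent the same
      limit point, which leaves only the two orders.\<close>
    have "\<not> divergent_pair p (\<phi> g \<circ> u) (\<phi> g \<circ> v)"
      using divergent_pair_isometry[of "\<phi> g"] iso not_div by blast
    then consider "divergent_pair p (\<phi> g \<circ> u) u" "divergent_pair p (\<phi> g \<circ> v) v" |
        "divergent_pair p (\<phi> g \<circ> v) u" "divergent_pair p (\<phi> g \<circ> u) v"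
      using perm[OF g(1) conv(1) u(2)] perm[OF g(1) conv(2) v(2)]
        divergent_pair_trans[of "\<phi> g \<circ> u" _ "\<phi> g \<circ> v"] divergent_pair_commute[of p "\<phi> g \<circ> v"] by blast
    then show ?thesis
    proof cases
      case 1
      then show ?thesis
        using gromov_product_bounded_transfer[OF 1 bound] unfolding C_def by simp
    next
      case 2
      show ?thesis
        using gromov_product_bounded_transfer[OF 2, of N y "R + dist p x\<^sub>0"] bound
        unfolding C_def by (simp add: gromov_product_commute)
    qed
  qed
  then show thesis using that u(2) conv by blast
qed

text \<open>The height is a Busemann function of the second limit point.  Since it is needed up to a
  bounded error only, it is read off at a single late term of the sequence, depending on the point.\<close>

lemma height_function_exists:
  assumes act: "isometric_action G \<phi>" and lim: "card (limit_set p G \<phi> x) = 2"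
  shows "\<exists>(h :: 'x \<Rightarrow> real) C. \<forall>y\<in>orbit G \<phi> x\<^sub>0. \<forall>z\<in>orbit G \<phi> x\<^sub>0. \<bar>\<bar>h y - h z\<bar> - dist y z\<bar> \<le> C"
proof -
  obtain u v C where v: "converges_to_infinity p v"
    and C: "\<And>y. y \<in> orbit G \<phi> x\<^sub>0 \<Longrightarrow> \<exists>N. \<forall>i\<ge>N. \<forall>j\<ge>N. gromov_product y (u i) (v j) \<le> C"
    using orbit_near_axis[OF assms] by metis
  define f where "f j y = dist y (v j) - dist x\<^sub>0 (v j)" for j y
  have "\<exists>J. \<forall>j\<ge>J. \<forall>k\<ge>J. f j y - f k y \<le> 2 * D" for y
  proof -
    obtain J where J: "\<forall>j\<ge>J. \<forall>k\<ge>J. dist y x\<^sub>0 + D + 1 \<le> gromov_product y (v j) (v k)"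
      using v[unfolded converges_to_infinity_def, THEN divergent_pairD] by blast
    have "f j y - f k y \<le> 2 * D" if jk: "j \<ge> J" "k \<ge> J" for j k
    proof -
      have "dist y x\<^sub>0 + D + 1 \<le> gromov_product y (v j) (v k)" using J jk by blast
      moreover have "dist y (v k) \<le> dist y x\<^sub>0 + dist x\<^sub>0 (v k)" by (rule dist_triangle)
      \<comment> \<open>The large product excludes the alternative of \<open>four_point_dist\<close>
        that pairs \<open>v j\<close> with \<open>v k\<close>; the other alternative is the
        claim.\<close>
      ultimately show ?thesis
        using four_point_dist[of y "v j" x\<^sub>0 "v k"] unfolding f_def gromov_product_def
        by (simp add: dist_commute max_def field_simps split: if_splits)
    qed
    then show ?thesis by blast
  qed
  then obtain J where J: "\<And>y j k. j \<ge> J y \<Longrightarrow> k \<ge> J y \<Longrightarrow> f j y - f k y \<le> 2 * D" by metis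
  define h where "h y = f (J y) y" for y
  \<comment> \<open>Comparison at a common late index \<open>j\<close> costs
    \<open>2 * \<bar>C\<bar> + 2 * D\<close>, and replacing each of the two heights by its value at
    \<open>j\<close> costs \<open>2 * D\<close>.\<close>
  have "\<bar>\<bar>h y - h z\<bar> - dist y z\<bar> \<le> 2 * \<bar>C\<bar> + 6 * D"
    if yz: "y \<in> orbit G \<phi> x\<^sub>0" "z \<in> orbit G \<phi> x\<^sub>0" for y z
  proof -
    obtain N M where N: "\<forall>i\<ge>N. \<forall>j\<ge>N. gromov_product y (u i) (v j) \<le> C"
      and M: "\<forall>i\<ge>M. \<forall>j\<ge>M. gromov_product z (u i) (v j) \<le> C"
      using C yz by meson
    define j where "j = max (max (J y) (J z)) (max N M)"
    define a where "a = u j"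
    define b where "b = v j"
    have "gromov_product y a b \<le> C" "gromov_product z a b \<le> C"
      using N M unfolding j_def a_def b_def by auto
    then have "dist y a + dist y b - dist a b \<le> 2 * C" "dist z a + dist z b - dist a b \<le> 2 * C"
      unfolding gromov_product_def by auto
    \<comment> \<open>As both products are at most \<open>C\<close>, this bounds
      \<open>dist y z\<close> by the difference of the distances to \<open>b\<close> up to a
      constant; the converse bound is the triangle inequality.\<close>
    moreover have "dist y z + dist a b \<le> max (dist y a + dist z b) (dist y b + dist z a) + 2 * D"
      by (rule four_point_dist)
    moreover have "dist y b \<le> dist y z + dist z b" "dist z b \<le> dist y z + dist y b"
      using dist_triangle[of y b z] dist_triangle[of z b y] by (auto simp: dist_commute)
    moreover have "dist a b \<le> dist y a + dist y b" "dist a b \<le> dist z a + dist z b"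
      using dist_triangle[of a b y] dist_triangle[of a b z] by (auto simp: dist_commute)
    ultimately have "\<bar>\<bar>dist y b - dist z b\<bar> - dist y z\<bar> \<le> 2 * \<bar>C\<bar> + 2 * D"
      using D_nonneg by linarith
    moreover have "\<bar>f j y - h y\<bar> \<le> 2 * D" "\<bar>f j z - h z\<bar> \<le> 2 * D"
      unfolding h_def abs_le_iff minus_diff_eq using J unfolding j_def by auto
    moreover have "f j y - f j z = dist y b - dist z b" unfolding f_def b_def by simp
    ultimately show ?thesis by linarith
  qed
  then show ?thesis by blast
qed

text \<open>The orbit of \<open>x\<close> contains a sequence tending to infinity, and corresponding
  points of the two orbits stay \<open>dist x x\<^sub>0\<close> apart.\<close>

lemma orbit_unbounded:
  assumes act: "isometric_action G \<phi>" and lim: "card (limit_set p G \<phi> x) = 2"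
  shows "\<exists>y\<in>orbit G \<phi> x\<^sub>0. R < dist y x\<^sub>0"
proof -
  obtain u where u: "range u \<subseteq> orbit G \<phi> x" "converges_to_infinity p u"
    using orbit_near_axis[OF assms] by metis
  obtain n where n: "R + 1 + dist x x\<^sub>0 \<le> gromov_product x\<^sub>0 (u n) (u n)"
    using u(2)[unfolded converges_to_infinity_def, THEN divergent_pairD] by blast
  obtain g where g: "g \<in> carrier G" "u n = \<phi> g x"
    using u(1) unfolding orbit_def by blast
  have "R + 1 + dist x x\<^sub>0 \<le> dist x\<^sub>0 (\<phi> g x)"
    using n unfolding gromov_product_def g by simp
  also have "\<dots> \<le> dist (\<phi> g x\<^sub>0) x\<^sub>0 + dist x x\<^sub>0"
    using dist_triangle[of x\<^sub>0 "\<phi> g x" "\<phi> g x\<^sub>0"] isometric_actionD(2)[OF act g(1), of x\<^sub>0 x]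
    by (simp add: dist_commute)
  finally show ?thesis using g(1) unfolding orbit_def by force
qed

end

subsection \<open>Relative index of commensurable sets\<close>

definition commensurable :: "'a set \<Rightarrow> 'a set \<Rightarrow> bool" where
  "commensurable A B \<longleftrightarrow> finite (A - B) \<and> finite (B - A)"

text \<open>Formally the size of \<open>B\<close> minus that of \<open>A\<close>. This is meaningful
  for commensurable sets only, as \<open>card\<close> is 0 on infinite sets.\<close>

definition rel_index :: "'a set \<Rightarrow> 'a set \<Rightarrow> int" where
  "rel_index A B = int (card (B - A)) - int (card (A - B))"

lemma commensurable_trans: "commensurable A B \<Longrightarrow> commensurable B E \<Longrightarrow> commensurable A E"
  unfolding commensurable_def
  using finite_subset[of "A - E" "(A - B) \<union> (B - E)"] finite_subset[of "E - A" "(E - B) \<union> (B - A)"]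
  by blast

lemma rel_index_self [simp]: "rel_index A A = 0"
  by (simp add: rel_index_def)

lemma rel_index_swap: "rel_index B A = - rel_index A B"
  by (simp add: rel_index_def)

text \<open>Inside a finite window containing the symmetric difference, the formal difference of
  sizes becomes an actual one. Additivity is then arithmetic in a common window.\<close>

lemma rel_index_eq_card_diff:
  assumes "finite T" "A - B \<subseteq> T" "B - A \<subseteq> T"
  shows "rel_index A B = int (card (B \<inter> T)) - int (card (A \<inter> T))"
proof -
  have "card (B \<inter> T) = card (B - A) + card (A \<inter> B \<inter> T)"
    using assms by (subst card_Un_disjoint[symmetric]) (auto intro: finite_subset arg_cong[where f = card])
  moreover have "card (A \<inter> T) = card (A - B) + card (A \<inter> B \<inter> T)"
    using assms by (subst card_Un_disjoint[symmetric]) (auto intro: finite_subset arg_cong[where f = card])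
  ultimately show ?thesis by (simp add: rel_index_def)
qed

lemma rel_index_add:
  assumes "commensurable A B" "commensurable B E"
  shows "rel_index A B + rel_index B E = rel_index A E"
proof -
  define T where "T = (A - B) \<union> (B - A) \<union> (B - E) \<union> (E - B)"
  have "finite T" using assms by (simp add: T_def commensurable_def)
  moreover have "A - B \<subseteq> T" "B - A \<subseteq> T" "B - E \<subseteq> T" "E - B \<subseteq> T" "A - E \<subseteq> T" "E - A \<subseteq> T"
    by (auto simp: T_def)
  ultimately show ?thesis
    by (simp add: rel_index_eq_card_diff[of T])
qed

lemma commensurable_image: "commensurable A B \<Longrightarrow> inj f \<Longrightarrow> commensurable (f ` A) (f ` B)"
  by (simp add: commensurable_def flip: image_set_diff)

lemma rel_index_image: "inj f \<Longrightarrow> rel_index (f ` A) (f ` B) = rel_index A B"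
  by (simp add: rel_index_def card_image inj_on_subset flip: image_set_diff)

lemma complement_Diff: "A \<subseteq> S \<Longrightarrow> B \<subseteq> S \<Longrightarrow> (S - A) - (S - B) = B - A"
  by blast

lemma commensurable_complement:
  "A \<subseteq> S \<Longrightarrow> B \<subseteq> S \<Longrightarrow> commensurable A B \<Longrightarrow> commensurable (S - A) (S - B)"
  by (simp add: commensurable_def complement_Diff)

lemma rel_index_complement:
  "A \<subseteq> S \<Longrightarrow> B \<subseteq> S \<Longrightarrow> rel_index (S - A) (S - B) = - rel_index A B"
  by (simp add: rel_index_def complement_Diff)

lemma abs_rel_index_le:
  assumes "finite T" "A - B \<subseteq> T" "B - A \<subseteq> T"
  shows "\<bar>rel_index A B\<bar> \<le> int (card T)"
  using card_mono[OF assms(1,2)] card_mono[OF assms(1,3)] by (simp add: rel_index_def)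


subsection \<open>Isometric actions on a coarse line\<close>

text \<open>Here \<open>r\<close> is the image of \<open>s\<close> under a coarse isometry fixing 0,
  and \<open>p\<close> that of an anchor \<open>q\<close>. Distances to 0 give \<open>r\<close> up
  to sign; the distance to an anchor far from 0 and of the right sign excludes the wrong
  one.\<close>

lemma coarse_isometry_of_line:
  fixes K :: real
  assumes "\<bar>\<bar>p\<bar> - \<bar>q\<bar>\<bar> \<le> K" "p > 0 \<longleftrightarrow> q > 0" "\<bar>q\<bar> > 2 * K"
    and "\<bar>\<bar>r\<bar> - \<bar>s\<bar>\<bar> \<le> K" "\<bar>\<bar>r - p\<bar> - \<bar>s - q\<bar>\<bar> \<le> K"
  shows "\<bar>r - s\<bar> \<le> 2 * K"
proof -
  have "\<bar>r - s\<bar> \<le> K \<or> \<bar>r + s\<bar> \<le> K" using assms(4) by linarith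
  moreover have "\<bar>(r - p) - (s - q)\<bar> \<le> K \<or> \<bar>(r - p) + (s - q)\<bar> \<le> K" using assms(5) by linarith
  moreover have "\<bar>p - q\<bar> \<le> K" using assms(1,2) by linarith
  ultimately show ?thesis using assms(3) by (elim disjE) linarith+
qed

text \<open>The first term to reach \<open>n\<close> overshoots it by at most one increment.\<close>

lemma int_sequence_hits_coarsely:
  fixes f :: "nat \<Rightarrow> int"
  assumes "f 0 \<le> n" "\<exists>i. n \<le> f i" "\<And>i. f (Suc i) \<le> f i + B" "0 \<le> B"
  shows "\<exists>i. \<bar>f i - n\<bar> \<le> B"
proof -
  define i where "i = (LEAST i. n \<le> f i)"
  have i: "n \<le> f i" unfolding i_def using LeastI_ex[OF assms(2)] .
  show ?thesis
  proof (cases i)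
    case 0
    then show ?thesis using i assms(1,4) by (intro exI[of _ i]) auto
  next
    case (Suc j)
    then have "f j < n" using not_less_Least[of j "\<lambda>i. n \<le> f i"] unfolding i_def by auto
    then show ?thesis using i assms(3)[of j] Suc by (intro exI[of _ i]) auto
  qed
qed

text \<open>The geometric input of the counting argument. How the group acts on heights is derived
  from \<open>isometry\<close> and \<open>height\<close>.\<close>

locale coarse_line_action =
  fixes G :: "('g, 'm) monoid_scheme" (structure)
    and \<phi> :: "'g \<Rightarrow> 'x \<Rightarrow> 'x::metric_space" and x\<^sub>0 :: 'x and h :: "'x \<Rightarrow> real" and C :: real
  assumes action: "group_action G UNIV \<phi>"
    and isometry: "\<And>g y z. g \<in> carrier G \<Longrightarrow> dist (\<phi> g y) (\<phi> g z) = dist y z"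
    and finite_ball: "\<And>R. finite {y \<in> orbit G \<phi> x\<^sub>0. dist y x\<^sub>0 \<le> R}"
    and height: "\<And>y z. y \<in> orbit G \<phi> x\<^sub>0 \<Longrightarrow> z \<in> orbit G \<phi> x\<^sub>0 \<Longrightarrow> \<bar>\<bar>h y - h z\<bar> - dist y z\<bar> \<le> C"
    and unbounded: "\<And>R. \<exists>y\<in>orbit G \<phi> x\<^sub>0. R < dist y x\<^sub>0"
begin

sublocale group_action G UNIV \<phi> by (rule action)
sublocale group G using group_hom group_hom_def by blast

abbreviation Orb :: "'x set" where "Orb \<equiv> orbit G \<phi> x\<^sub>0"

lemma act_mult: "g \<in> carrier G \<Longrightarrow> g' \<in> carrier G \<Longrightarrow> \<phi> (g \<otimes> g') y = \<phi> g (\<phi> g' y)"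
  by (simp add: composition_rule)

lemma act_one: "\<phi> \<one> y = y"
  using id_eq_one by (metis UNIV_I restrict_apply')

lemma act_inv: "g \<in> carrier G \<Longrightarrow> \<phi> g (\<phi> (inv g) y) = y" "g \<in> carrier G \<Longrightarrow> \<phi> (inv g) (\<phi> g y) = y"
  by (simp_all add: act_one flip: act_mult)

lemma act_inj: "g \<in> carrier G \<Longrightarrow> inj (\<phi> g)"
  using inj_prop by blast

lemma base_in_Orb: "x\<^sub>0 \<in> Orb"
  unfolding orbit_def using act_one[of x\<^sub>0] by (auto intro: exI[of _ \<one>])

lemma Orb_closed: "g \<in> carrier G \<Longrightarrow> y \<in> Orb \<Longrightarrow> \<phi> g y \<in> Orb"
  using orbit_closed[OF action] .

lemma act_Orb: "g \<in> carrier G \<Longrightarrow> \<phi> g ` Orb = Orb"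
  using Orb_closed act_inv(1) by (auto simp: image_iff) (metis inv_closed)

lemma OrbE: assumes "y \<in> Orb" obtains g where "g \<in> carrier G" "y = \<phi> g x\<^sub>0"
  using assms unfolding orbit_def by blast

lemma C_nonneg: "0 \<le> C"
  using height[OF base_in_Orb base_in_Orb] by simp

lemma height_unbounded: "\<exists>g\<in>carrier G. R < \<bar>h (\<phi> g x\<^sub>0) - h x\<^sub>0\<bar>"
proof -
  obtain y where y: "y \<in> Orb" "R + C < dist y x\<^sub>0" using unbounded by blast
  then obtain g where g: "g \<in> carrier G" "y = \<phi> g x\<^sub>0" by (elim OrbE)
  have "R < \<bar>h y - h x\<^sub>0\<bar>" using height[OF y(1) base_in_Orb] y(2) by linarith
  then show ?thesis using g by blast
qed

section \<open>Orientation of group elements\<close>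

definition flips :: "'g \<Rightarrow> bool" where
  "flips g \<longleftrightarrow> \<not> (\<forall>y\<in>Orb. \<forall>z\<in>Orb. \<bar>(h (\<phi> g y) - h (\<phi> g z)) - (h y - h z)\<bar> \<le> 8 * C)"

definition orientation :: "'g \<Rightarrow> int" where
  "orientation g = (if flips g then -1 else 1)"

lemma orientation_cases: "orientation g = 1 \<or> orientation g = -1"
  by (simp add: orientation_def)

text \<open>Heights after \<open>g\<close> form a coarsely isometric copy of the heights before. The
  sign \<open>s\<close> is read off at one far point \<open>b\<close>;
  \<open>coarse_isometry_of_line\<close> with constant \<open>2 * C\<close> propagates it to all
  points relative to \<open>x\<^sub>0\<close>, and comparing two points doubles the error
  \<open>4 * C\<close>.\<close>

lemma orientation_height:
  assumes g: "g \<in> carrier G" and yz: "y \<in> Orb" "z \<in> Orb"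
  shows "\<bar>(h (\<phi> g y) - h (\<phi> g z)) - orientation g * (h y - h z)\<bar> \<le> 8 * C"
proof -
  define f where "f y = h (\<phi> g y)" for y
  obtain b where b: "b \<in> Orb" "4 * C < \<bar>h b - h x\<^sub>0\<bar>"
    using height_unbounded[of "4 * C"] Orb_closed base_in_Orb by blast
  have coarse: "\<bar>\<bar>f y - f z\<bar> - \<bar>h y - h z\<bar>\<bar> \<le> 2 * C" if "y \<in> Orb" "z \<in> Orb" for y z
    using height[OF that] height[OF Orb_closed[OF g that(1)] Orb_closed[OF g that(2)]] isometry[OF g]
    unfolding f_def by fastforce
  have fb: "f b \<noteq> f x\<^sub>0"
  proof
    assume "f b = f x\<^sub>0"
    then show False using coarse[OF b(1) base_in_Orb] b(2) C_nonneg by simp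
  qed
  define s :: real where "s = (if f b - f x\<^sub>0 > 0 \<longleftrightarrow> h b - h x\<^sub>0 > 0 then 1 else -1)"
  have anchored: "\<bar>s * (f y - f x\<^sub>0) - (h y - h x\<^sub>0)\<bar> \<le> 4 * C" if "y \<in> Orb" for y
  proof -
    have "\<bar>\<bar>s * (f y - f x\<^sub>0) - s * (f b - f x\<^sub>0)\<bar> - \<bar>(h y - h x\<^sub>0) - (h b - h x\<^sub>0)\<bar>\<bar> \<le> 2 * C"
      using coarse[OF that b(1)] unfolding s_def by (auto simp: algebra_simps abs_minus_commute)
    moreover have "\<bar>\<bar>s * (f b - f x\<^sub>0)\<bar> - \<bar>h b - h x\<^sub>0\<bar>\<bar> \<le> 2 * C"
      "\<bar>\<bar>s * (f y - f x\<^sub>0)\<bar> - \<bar>h y - h x\<^sub>0\<bar>\<bar> \<le> 2 * C"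
      using coarse[OF b(1) base_in_Orb] coarse[OF that base_in_Orb] unfolding s_def abs_mult by auto
    moreover have "s * (f b - f x\<^sub>0) > 0 \<longleftrightarrow> h b - h x\<^sub>0 > 0"
      using fb unfolding s_def by auto
    ultimately show ?thesis
      using coarse_isometry_of_line[of "s * (f b - f x\<^sub>0)" "h b - h x\<^sub>0" "2 * C" "s * (f y - f x\<^sub>0)" "h y - h x\<^sub>0"]
        b(2) by simp
  qed
  have s: "\<bar>(f y - f z) - s * (h y - h z)\<bar> \<le> 8 * C" if "y \<in> Orb" "z \<in> Orb" for y z
    using anchored[OF that(1)] anchored[OF that(2)] unfolding s_def by (auto split: if_splits)
  show ?thesis
  proof (cases "flips g")
    case True
    \<comment> \<open>\<open>flips\<close> denies exactly the estimate with sign 1.\<close>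
    then have "s \<noteq> 1" using s unfolding flips_def f_def by force
    then have "s = -1" unfolding s_def by (simp split: if_splits)
    then show ?thesis using s[OF yz] True unfolding orientation_def f_def by simp
  next
    case False
    then show ?thesis using yz unfolding flips_def orientation_def by simp
  qed
qed

text \<open>Two different signs would bound the heights on the orbit. Any constant \<open>K\<close>
  is allowed, so that estimates for products, whose errors add up, also determine the sign.\<close>

lemma orientation_unique:
  assumes g: "g \<in> carrier G" and s: "s = 1 \<or> s = -1"
    and K: "\<And>y z. y \<in> Orb \<Longrightarrow> z \<in> Orb \<Longrightarrow> \<bar>(h (\<phi> g y) - h (\<phi> g z)) - of_int s * (h y - h z)\<bar> \<le> K"
  shows "orientation g = s"
proof (rule ccontr)
  assume neq: "orientation g \<noteq> s"
  obtain y where y: "y \<in> Orb" "K + 8 * C < \<bar>h y - h x\<^sub>0\<bar>"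
    using height_unbounded[of "K + 8 * C"] Orb_closed base_in_Orb by blast
  then show False
    using K[OF y(1) base_in_Orb] orientation_height[OF g y(1) base_in_Orb] s orientation_cases[of g] neq by auto
qed

lemma orientation_mult:
  assumes g: "g \<in> carrier G" and g': "g' \<in> carrier G"
  shows "orientation (g \<otimes> g') = orientation g * orientation g'"
proof (rule orientation_unique)
  fix y z assume yz: "y \<in> Orb" "z \<in> Orb"
  show "\<bar>(h (\<phi> (g \<otimes> g') y) - h (\<phi> (g \<otimes> g') z)) - of_int (orientation g * orientation g') * (h y - h z)\<bar> \<le> 16 * C"
    using orientation_height[OF g Orb_closed[OF g' yz(1)] Orb_closed[OF g' yz(2)]] orientation_height[OF g' yz]
      orientation_cases[of g] orientation_cases[of g'] act_mult[OF g g'] by auto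
qed (use g g' orientation_cases[of g] orientation_cases[of g'] in auto)

lemma orientation_one: "orientation \<one> = 1"
  using C_nonneg by (intro orientation_unique[of _ _ 0]) (auto simp: act_one)

section \<open>Slabs, rays and their images under the group\<close>

definition ball_card :: "real \<Rightarrow> nat" where
  "ball_card R = card {y \<in> Orb. dist y x\<^sub>0 \<le> R}"

text \<open>A nonempty slab lies in the ball of radius \<open>2 * K + C\<close> about any of its
  points, and a group element carries this ball to one about \<open>x\<^sub>0\<close>. Hence the
  bound is independent of the height \<open>s\<close>.\<close>

lemma slab:
  shows finite_slab: "finite {z \<in> Orb. \<bar>h z - s\<bar> \<le> K}"
    and card_slab_le: "card {z \<in> Orb. \<bar>h z - s\<bar> \<le> K} \<le> ball_card (2 * K + C)"
proof -
  let ?S = "{z \<in> Orb. \<bar>h z - s\<bar> \<le> K}" and ?B = "{y \<in> Orb. dist y x\<^sub>0 \<le> 2 * K + C}"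
  have "finite ?S \<and> card ?S \<le> card ?B"
  proof (cases "?S = {}")
    case True
    then show ?thesis by (simp del: Collect_empty_eq)
  next
    case False
    then obtain w where w: "w \<in> Orb" "\<bar>h w - s\<bar> \<le> K" by blast
    then obtain g where g: "g \<in> carrier G" "w = \<phi> g x\<^sub>0" by (elim OrbE)
    have "?S \<subseteq> \<phi> g ` ?B"
    proof
      fix z assume z: "z \<in> ?S"
      have "dist z w \<le> 2 * K + C"
        using height[of z w] z w by auto
      then have "dist (\<phi> (inv g) z) x\<^sub>0 \<le> 2 * K + C"
        using isometry[of "inv g" z w] act_inv(2)[of g x\<^sub>0] g by simp
      then show "z \<in> \<phi> g ` ?B"
        using z g(1) by (intro image_eqI[of _ _ "\<phi> (inv g) z"]) (auto simp: act_inv Orb_closed)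
    qed
    then show ?thesis
      using finite_ball surj_card_le by (meson finite_imageI finite_subset)
  qed
  then show "finite ?S" "card ?S \<le> ball_card (2 * K + C)"
    by (auto simp: ball_card_def)
qed

definition ray :: "real \<Rightarrow> 'x set" where
  "ray s = {y \<in> Orb. s \<le> h y}"

text \<open>The complement turns the image of a ray under a reversing element back into an upward
  ray, up to finitely many points.\<close>

definition move :: "'g \<Rightarrow> 'x set \<Rightarrow> 'x set" where
  "move g A = (if flips g then Orb - \<phi> g ` A else \<phi> g ` A)"

lemma ray_subset: "ray s \<subseteq> Orb"
  by (auto simp: ray_def)

lemma move_subset: "g \<in> carrier G \<Longrightarrow> A \<subseteq> Orb \<Longrightarrow> move g A \<subseteq> Orb"
  using act_Orb by (auto simp: move_def)

lemma move_one: "move \<one> A = A"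
  using orientation_one by (simp add: move_def orientation_def act_one split: if_splits)

text \<open>Complements in the orbit commute with \<open>\<phi> g\<close> and cancel in pairs, so
  multiplicativity of \<open>orientation\<close> makes \<open>move\<close> an action on subsets of
  the orbit.\<close>

lemma move_mult:
  assumes "g \<in> carrier G" "g' \<in> carrier G" "A \<subseteq> Orb"
  shows "move (g \<otimes> g') A = move g (move g' A)"
proof -
  have "\<phi> (g \<otimes> g') ` A = \<phi> g ` \<phi> g' ` A"
    by (simp add: act_mult assms image_image)
  moreover have "\<phi> g ` (Orb - \<phi> g' ` A) = Orb - \<phi> g ` \<phi> g' ` A"
    using assms by (simp add: image_set_diff act_inj act_Orb)
  moreover have "\<phi> g ` \<phi> g' ` A \<subseteq> Orb"
    using assms act_Orb by blast
  ultimately show ?thesis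
    using orientation_mult[OF assms(1,2)] by (auto simp: move_def orientation_def split: if_splits)
qed

lemma commensurable_move:
  assumes "g \<in> carrier G" "A \<subseteq> Orb" "B \<subseteq> Orb" "commensurable A B"
  shows "commensurable (move g A) (move g B)"
  using assms act_Orb[of g]
  by (auto simp: move_def intro!: commensurable_image commensurable_complement act_inj)

text \<open>Injective images keep the index and complements negate it; hence the linear part of
  \<open>line_action\<close>.\<close>

lemma rel_index_move:
  assumes "g \<in> carrier G" "A \<subseteq> Orb" "B \<subseteq> Orb"
  shows "rel_index (move g A) (move g B) = orientation g * rel_index A B"
proof -
  have "\<phi> g ` A \<subseteq> Orb" "\<phi> g ` B \<subseteq> Orb" using assms act_Orb by blast+
  then show ?thesis
    using assms by (simp add: move_def orientation_def rel_index_complement rel_index_image act_inj)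
qed

lemma commensurable_ray: "commensurable (ray s) (ray t)"
  unfolding commensurable_def ray_def
  by (intro conjI finite_subset[OF _ finite_slab[of s "\<bar>t - s\<bar>"]]) auto

text \<open>Membership of \<open>\<phi> g w\<close> in the moved ray depends on how
  \<open>h w\<close> compares with \<open>h y\<close>. By \<open>orientation_height\<close> the
  comparison survives applying \<open>g\<close>, except within \<open>8 * C\<close> of the height of
  \<open>\<phi> g y\<close>.\<close>

lemma move_ray:
  assumes g: "g \<in> carrier G" and y: "y \<in> Orb"
  defines "S \<equiv> {z \<in> Orb. \<bar>h z - h (\<phi> g y)\<bar> \<le> 8 * C}"
  shows "move g (ray (h y)) - ray (h (\<phi> g y)) \<subseteq> S" "ray (h (\<phi> g y)) - move g (ray (h y)) \<subseteq> S"
proof -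
  have "z \<in> S" if z: "z \<in> Orb" "z \<in> move g (ray (h y)) \<longleftrightarrow> z \<notin> ray (h (\<phi> g y))" for z
  proof -
    define w where "w = \<phi> (inv g) z"
    have w: "w \<in> Orb" "z = \<phi> g w"
      using z g by (simp_all add: w_def Orb_closed act_inv)
    have "z \<in> \<phi> g ` ray (h y) \<longleftrightarrow> w \<in> ray (h y)"
      using w act_inj[OF g] by (simp add: inj_image_mem_iff)
    then have "z \<in> move g (ray (h y)) \<longleftrightarrow> (if flips g then h w < h y else h y \<le> h w)"
      using w z(1) by (auto simp: move_def ray_def)
    then show ?thesis
      using z w(2) orientation_height[OF g w(1) y] C_nonneg by (auto simp: S_def ray_def orientation_def split: if_splits)
  qed
  then show "move g (ray (h y)) - ray (h (\<phi> g y)) \<subseteq> S" "ray (h (\<phi> g y)) - move g (ray (h y)) \<subseteq> S"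
    using move_subset[OF g ray_subset[of "h y"]] ray_subset[of "h (\<phi> g y)"] by blast+
qed

lemma commensurable_move_ray:
  assumes g: "g \<in> carrier G"
  shows "commensurable (ray s) (move g (ray t))"
proof -
  have "commensurable (ray (h (\<phi> g x\<^sub>0))) (move g (ray (h x\<^sub>0)))"
    unfolding commensurable_def using move_ray[OF g base_in_Orb] finite_slab finite_subset by blast
  then show ?thesis
    using commensurable_ray commensurable_trans commensurable_move[OF g ray_subset ray_subset] by blast
qed

section \<open>The relative index and the action on the integers\<close>

definition index :: "'x \<Rightarrow> int" where
  "index y = rel_index (ray (h x\<^sub>0)) (ray (h y))"

definition shift :: "'g \<Rightarrow> int" where
  "shift g = rel_index (ray (h x\<^sub>0)) (move g (ray (h x\<^sub>0)))"

text \<open>The action on sets commensurable to a ray, modulo those of relative index 0: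
  elements reversing the line are composed with the complement.\<close>

definition line_action :: "'g \<Rightarrow> int \<Rightarrow> int" where
  "line_action g n = orientation g * n + shift g"

text \<open>A twisted cocycle identity: the index is additive along the base ray, its image under
  \<open>g\<close> and its image under \<open>g \<otimes> g'\<close>, and \<open>move g\<close>
  scales the second summand by the orientation.\<close>

lemma shift_mult:
  assumes "g \<in> carrier G" "g' \<in> carrier G"
  shows "shift (g \<otimes> g') = orientation g * shift g' + shift g"
proof -
  let ?R = "ray (h x\<^sub>0)"
  have "shift g + rel_index (move g ?R) (move g (move g' ?R)) = shift (g \<otimes> g')"
    unfolding shift_def move_mult[OF assms ray_subset]
    by (intro rel_index_add commensurable_move commensurable_move_ray ray_subset move_subset assms)
  then show ?thesis
    using assms by (simp add: rel_index_move ray_subset move_subset shift_def)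
qed

lemma line_action_mult:
  "g \<in> carrier G \<Longrightarrow> g' \<in> carrier G \<Longrightarrow> line_action (g \<otimes> g') n = line_action g (line_action g' n)"
  by (simp add: line_action_def orientation_mult shift_mult algebra_simps)

lemma bij_line_action: "bij (line_action g)"
  by (rule bij_betw_byWitness[of _ "\<lambda>n. orientation g * (n - shift g)"])
    (use orientation_cases[of g] in \<open>auto simp: line_action_def\<close>)

lemma line_automorphism_line_action: "line_automorphism (line_action g)"
  using bij_line_action orientation_cases[of g]
  by (auto simp: line_automorphism_def line_adjacent_def line_action_def)

lemma group_action_line_action: "group_action G UNIV line_action"
proof -
  have "line_action \<in> hom G (BijGroup UNIV)"
    using bij_line_action
    by (auto simp: hom_def BijGroup_def Bij_def compose_def line_action_mult fun_eq_iff)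
  then show ?thesis
    unfolding group_action_def group_hom_def group_hom_axioms_def
    using group_BijGroup is_group by blast
qed

lemma line_realization_line_action:
  "line_realization (line_action g) t = orientation g * t + shift g" for t :: real
proof -
  have "line_realization (line_action g) t = orientation g * (of_int \<lfloor>t\<rfloor> + frac t) + shift g"
    by (simp add: line_realization_def line_action_def algebra_simps)
  then show ?thesis by (simp add: frac_def)
qed

text \<open>Additivity identifies \<open>line_action g (index y)\<close> with the index of the moved
  ray \<open>?A\<close>, which differs from the ray at \<open>\<phi> g y\<close> only in a slab of
  half-width \<open>8 * C\<close>. The radius \<open>17 * C\<close> is
  \<open>2 * (8 * C) + C\<close>.\<close>

lemma index_equivariant:
  assumes g: "g \<in> carrier G" and y: "y \<in> Orb"
  shows "\<bar>index (\<phi> g y) - line_action g (index y)\<bar> \<le> int (ball_card (17 * C))"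
proof -
  let ?R = "ray (h x\<^sub>0)" and ?A = "move g (ray (h y))" and ?B = "ray (h (\<phi> g y))"
  have "line_action g (index y) = rel_index ?R (move g ?R) + rel_index (move g ?R) ?A"
    by (simp add: line_action_def index_def shift_def rel_index_move[OF g] ray_subset)
  also have "\<dots> = rel_index ?R ?A"
    by (intro rel_index_add commensurable_move_ray commensurable_move commensurable_ray ray_subset g)
  also have "\<dots> = rel_index ?R ?B + rel_index ?B ?A"
    by (intro rel_index_add[symmetric] commensurable_move_ray commensurable_ray g)
  finally have "\<bar>index (\<phi> g y) - line_action g (index y)\<bar> = \<bar>rel_index ?A ?B\<bar>"
    by (simp add: index_def rel_index_swap[of ?A])
  also have "\<dots> \<le> int (card {z \<in> Orb. \<bar>h z - h (\<phi> g y)\<bar> \<le> 8 * C})"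
    by (rule abs_rel_index_le[OF finite_slab move_ray[OF g y]])
  also have "\<dots> \<le> int (ball_card (17 * C))"
    using card_slab_le[of "h (\<phi> g y)" "8 * C"] by simp
  finally show ?thesis .
qed

section \<open>A translation in the group\<close>

text \<open>The displacement of an orientation-preserving element varies by at most
  \<open>8 * C\<close>. If it exceeds \<open>8 * C + 1\<close> at \<open>x\<^sub>0\<close>, all
  points move at least 1 in the same direction, which is upward for the element or its
  inverse.\<close>

lemma translation_exists:
  "\<exists>t\<in>carrier G. \<exists>S\<ge>1. \<forall>y\<in>Orb. 1 \<le> h (\<phi> t y) - h y \<and> h (\<phi> t y) - h y \<le> S"
proof -
  define d where "d g y = h (\<phi> g y) - h y" for g y
  have "\<exists>g\<in>carrier G. orientation g = 1 \<and> 8 * C + 1 < \<bar>d g x\<^sub>0\<bar>"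
  proof (rule ccontr)
    assume none: "\<not> ?thesis"
    obtain g where g: "g \<in> carrier G" "8 * C + 1 < \<bar>d g x\<^sub>0\<bar>"
      using height_unbounded d_def by metis
    \<comment> \<open>If both elements reverse the line, their product preserves it and displaces
      \<open>x\<^sub>0\<close> by the difference of the two displacements up to
      \<open>8 * C\<close>. The margin \<open>16 * C + 1\<close> makes this exceed
      \<open>8 * C + 1\<close>.\<close>
    obtain g' where g': "g' \<in> carrier G" "\<bar>d g x\<^sub>0\<bar> + 16 * C + 1 < \<bar>d g' x\<^sub>0\<bar>"
      using height_unbounded d_def by metis
    have "orientation g = -1" "orientation g' = -1"
      using none g g' orientation_cases C_nonneg by fastforce+
    then have "orientation (g' \<otimes> g) = 1" and flip: "\<bar>h (\<phi> g' (\<phi> g x\<^sub>0)) - h (\<phi> g' x\<^sub>0) + d g x\<^sub>0\<bar> \<le> 8 * C"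
      using orientation_mult[OF g'(1) g(1)] orientation_height[OF g'(1) Orb_closed[OF g(1) base_in_Orb] base_in_Orb]
      by (auto simp: d_def)
    then have "\<bar>d (g' \<otimes> g) x\<^sub>0\<bar> \<le> 8 * C + 1"
      using none g(1) g'(1) by fastforce
    then have "\<bar>h (\<phi> g' (\<phi> g x\<^sub>0)) - h x\<^sub>0\<bar> \<le> 8 * C + 1"
      using act_mult[OF g'(1) g(1)] by (simp add: d_def)
    moreover have "d g' x\<^sub>0 = h (\<phi> g' x\<^sub>0) - h x\<^sub>0" by (simp add: d_def)
    ultimately show False using flip g'(2) by linarith
  qed
  then obtain g where g: "g \<in> carrier G" "orientation g = 1" "8 * C + 1 < \<bar>d g x\<^sub>0\<bar>" by blast
  have near: "\<bar>d g y - d g x\<^sub>0\<bar> \<le> 8 * C" if "y \<in> Orb" for y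
    using orientation_height[OF g(1) that base_in_Orb] g(2) by (simp add: d_def algebra_simps)
  define S where "S = \<bar>d g x\<^sub>0\<bar> + 8 * C"
  have S: "1 \<le> S" using g(3) C_nonneg by (simp add: S_def)
  show ?thesis
  proof (cases "d g x\<^sub>0 > 0")
    case True
    have "1 \<le> d g y \<and> d g y \<le> S" if "y \<in> Orb" for y
      using near[OF that] True g(3) unfolding S_def by linarith
    then show ?thesis using S g(1) unfolding d_def by blast
  next
    case False
    have "1 \<le> d (inv g) y \<and> d (inv g) y \<le> S" if "y \<in> Orb" for y
    proof -
      have "d (inv g) y = - d g (\<phi> (inv g) y)"
        using g(1) by (simp add: d_def act_inv)
      then show ?thesis
        using near[of "\<phi> (inv g) y"] Orb_closed[of "inv g" y] that False g unfolding S_def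
        by (auto simp: abs_le_iff)
    qed
    then show ?thesis using S g(1) unfolding d_def by blast
  qed
qed

definition translation :: "'g" where
  "translation = (SOME t. t \<in> carrier G \<and>
     (\<exists>S\<ge>1. \<forall>y\<in>Orb. 1 \<le> h (\<phi> t y) - h y \<and> h (\<phi> t y) - h y \<le> S))"

definition step :: real where
  "step = (SOME S. 1 \<le> S \<and>
     (\<forall>y\<in>Orb. 1 \<le> h (\<phi> translation y) - h y \<and> h (\<phi> translation y) - h y \<le> S))"

lemma translation_in_carrier: "translation \<in> carrier G"
  and step_ge_1: "1 \<le> step"
  and height_translation: "y \<in> Orb \<Longrightarrow> 1 \<le> h (\<phi> translation y) - h y"
    "y \<in> Orb \<Longrightarrow> h (\<phi> translation y) - h y \<le> step"
proof -
  have t: "translation \<in> carrier G \<and> (\<exists>S\<ge>1. \<forall>y\<in>Orb. 1 \<le> h (\<phi> translation y) - h y \<and> h (\<phi> translation y) - h y \<le> S)"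
    unfolding translation_def by (rule someI_ex) (use translation_exists in blast)
  have "1 \<le> step \<and> (\<forall>y\<in>Orb. 1 \<le> h (\<phi> translation y) - h y \<and> h (\<phi> translation y) - h y \<le> step)"
    unfolding step_def by (rule someI_ex) (use t in blast)
  then show "translation \<in> carrier G" "1 \<le> step"
    "y \<in> Orb \<Longrightarrow> 1 \<le> h (\<phi> translation y) - h y" "y \<in> Orb \<Longrightarrow> h (\<phi> translation y) - h y \<le> step"
    using t by blast+
qed

lemma translation_power:
  assumes "y \<in> Orb"
  shows "(\<phi> translation ^^ i) y \<in> Orb"
    and "h ((\<phi> translation ^^ i) y) \<le> h y + i * step"
  using assms
proof (induction i)
  case (Suc i)
  { case 1 then show ?case using Suc(1) Orb_closed translation_in_carrier by simp }
  { case 2 then show ?case using Suc height_translation(2)[of "(\<phi> translation ^^ i) y"]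
      by (simp add: algebra_simps) }
qed auto

section \<open>Comparison of the index with the distance\<close>

text \<open>The order is reversed: rays shrink as their starting height grows, so the index falls
  with the height.\<close>

lemma index_diff:
  assumes "h y \<le> h z"
  shows "index y - index z = int (card {w \<in> Orb. h y \<le> h w \<and> h w < h z})"
proof -
  have "index z + rel_index (ray (h z)) (ray (h y)) = index y"
    unfolding index_def by (intro rel_index_add commensurable_ray)
  moreover have "ray (h z) - ray (h y) = {}" "ray (h y) - ray (h z) = {w \<in> Orb. h y \<le> h w \<and> h w < h z}"
    using assms by (auto simp: ray_def)
  ultimately show ?thesis by (simp add: rel_index_def)
qed

lemma finite_half_open_slab: "finite {w \<in> Orb. s \<le> h w \<and> h w < t}"
  by (rule finite_subset[OF _ finite_slab[of s "t - s"]]) auto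

text \<open>The iterates of the translation at \<open>y\<close> are distinct and climb by at most
  \<open>step\<close> each, so enough of them lie between the two heights.\<close>

lemma index_lower:
  assumes y: "y \<in> Orb" and le: "h y \<le> h z"
  shows "(h z - h y) / step \<le> index y - index z"
proof -
  define n where "n = nat \<lceil>(h z - h y) / step\<rceil>"
  define f where "f i = (\<phi> translation ^^ i) y" for i
  have "h (f i) < h (f (Suc i))" for i
    using height_translation(1)[OF translation_power(1)[OF y, of i]] by (simp add: f_def)
  then have mono: "strict_mono (\<lambda>i. h (f i))" by (simp add: strict_mono_Suc_iff)
  then have "inj f" unfolding strict_mono_def by (metis injI linorder_neqE_nat less_irrefl)
  have "f i \<in> {w \<in> Orb. h y \<le> h w \<and> h w < h z}" if "i < n" for i
  proof -
    have "real i < (h z - h y) / step"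
      using that unfolding n_def by (simp add: zless_nat_eq_int_zless less_ceiling_iff)
    then have "i * step < h z - h y" using step_ge_1 by (simp add: pos_less_divide_eq)
    moreover have "h (f 0) \<le> h (f i)" using strict_mono_less_eq[OF mono] by blast
    ultimately show ?thesis
      using translation_power[OF y, of i] by (simp add: f_def)
  qed
  then have "f ` {..<n} \<subseteq> {w \<in> Orb. h y \<le> h w \<and> h w < h z}" by blast
  from card_mono[OF finite_half_open_slab this] have "n \<le> card {w \<in> Orb. h y \<le> h w \<and> h w < h z}"
    using card_image[OF inj_on_subset[OF \<open>inj f\<close> subset_UNIV], of "{..<n}"] by simp
  then have "real n \<le> index y - index z"
    using index_diff[OF le] by linarith
  moreover have "(h z - h y) / step \<le> real n"
    unfolding n_def by linarith
  ultimately show ?thesis by linarith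
qed

text \<open>The half-open slab is covered by \<open>n\<close> slabs of half-width 1, each with at
  most \<open>ball_card (2 + C)\<close> points; rounding up to \<open>n\<close> accounts for the
  summand 1.\<close>

lemma index_upper:
  assumes le: "h y \<le> h z"
  shows "index y - index z \<le> ball_card (2 + C) * (h z - h y + 1)"
proof -
  define n where "n = nat \<lceil>h z - h y\<rceil>"
  let ?slab = "\<lambda>k. {w \<in> Orb. \<bar>h w - (h y + real k)\<bar> \<le> 1}"
  have "{w \<in> Orb. h y \<le> h w \<and> h w < h z} \<subseteq> (\<Union>k<n. ?slab k)"
  proof clarify
    fix w assume w: "w \<in> Orb" "h y \<le> h w" "h w < h z"
    define k where "k = nat \<lfloor>h w - h y\<rfloor>"
    have k: "real k \<le> h w - h y" "h w - h y < real k + 1"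
      using w(2) unfolding k_def by linarith+
    then have "k < n"
      using w(3) unfolding n_def by linarith
    then show "w \<in> (\<Union>k<n. ?slab k)" using w(1) k by force
  qed
  then have "card {w \<in> Orb. h y \<le> h w \<and> h w < h z} \<le> card (\<Union>k<n. ?slab k)"
    by (intro card_mono finite_UN_I finite_slab) auto
  also have "\<dots> \<le> (\<Sum>k<n. card (?slab k))" by (rule card_UN_le) simp
  also have "\<dots> \<le> (\<Sum>k<n. ball_card (2 + C))"
    by (intro sum_mono) (use card_slab_le[where K = 1] in simp)
  finally have "card {w \<in> Orb. h y \<le> h w \<and> h w < h z} \<le> n * ball_card (2 + C)" by simp
  then have "index y - index z \<le> int (n * ball_card (2 + C))"
    unfolding index_diff[OF le] by (simp only: of_nat_le_iff)
  then have "real_of_int (index y - index z) \<le> real n * ball_card (2 + C)"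
    by (metis of_int_le_iff of_int_of_nat_eq of_nat_mult)
  also have "\<dots> \<le> (h z - h y + 1) * ball_card (2 + C)"
    using le unfolding n_def by (intro mult_right_mono) linarith+
  finally show ?thesis by (simp add: mult.commute)
qed

lemma index_bounds:
  assumes y: "y \<in> Orb" and z: "z \<in> Orb"
  shows "dist y z \<le> step * \<bar>index y - index z\<bar> + C"
    and "\<bar>index y - index z\<bar> \<le> ball_card (2 + C) * (dist y z + C + 1)"
proof -
  have "\<bar>h y - h z\<bar> \<le> step * \<bar>index y - index z\<bar> \<and>
      \<bar>index y - index z\<bar> \<le> ball_card (2 + C) * (\<bar>h y - h z\<bar> + 1)"
    if "y \<in> Orb" "h y \<le> h z" for y z
  proof -
    have "h z - h y \<le> step * (index y - index z)"
      using index_lower[OF that] step_ge_1 by (simp add: divide_le_eq mult.commute)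
    moreover have "index y - index z \<ge> 0" using index_diff[OF that(2)] by simp
    ultimately show ?thesis using index_upper[OF that(2)] that(2) by simp
  qed
  from this[of y z] this[of z y]
  have *: "\<bar>h y - h z\<bar> \<le> step * \<bar>index y - index z\<bar>"
    "\<bar>index y - index z\<bar> \<le> ball_card (2 + C) * (\<bar>h y - h z\<bar> + 1)"
    using y z by (cases "h y \<le> h z"; simp add: abs_minus_commute)+
  show "dist y z \<le> step * \<bar>index y - index z\<bar> + C"
    using *(1) height[OF y z] by linarith
  have "ball_card (2 + C) * (\<bar>h y - h z\<bar> + 1) \<le> ball_card (2 + C) * (dist y z + C + 1)"
    using height[OF y z] by (intro mult_left_mono) auto
  then show "\<bar>index y - index z\<bar> \<le> ball_card (2 + C) * (dist y z + C + 1)"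
    using *(2) by linarith
qed

lemma ball_card_pos: "0 \<le> R \<Longrightarrow> 1 \<le> ball_card R"
proof -
  assume "0 \<le> R"
  then have "x\<^sub>0 \<in> {y \<in> Orb. dist y x\<^sub>0 \<le> R}" using base_in_Orb by simp
  then have "card {y \<in> Orb. dist y x\<^sub>0 \<le> R} \<noteq> 0" using finite_ball by (metis card_0_eq empty_iff)
  then show ?thesis by (simp add: ball_card_def)
qed

text \<open>The translation lowers the index by at least 1 and at most \<open>B\<close>, and its
  inverse raises it likewise. Iterating from \<open>x\<^sub>0\<close>, whose index is 0, comes
  within \<open>B\<close> of every integer.\<close>

lemma index_coarsely_surjective: "\<exists>B\<ge>0. \<forall>n. \<exists>y\<in>Orb. \<bar>index y - n\<bar> \<le> B"
proof -
  define T where "T = \<phi> translation"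
  define T' where "T' = \<phi> (inv translation)"
  \<comment> \<open>The bound of \<open>index_upper\<close> for a height difference of at most
    \<open>step\<close>.\<close>
  define B where "B = \<lceil>ball_card (2 + C) * (step + 1)\<rceil>"
  have B: "0 \<le> B" proof -
    have "0 \<le> ball_card (2 + C) * (step + 1)" using step_ge_1 by simp
    then show ?thesis unfolding B_def by linarith
  qed
  have Orb: "T y \<in> Orb" "T' y \<in> Orb" if "y \<in> Orb" for y
    using that translation_in_carrier Orb_closed unfolding T_def T'_def by auto
  have "index y - index (T y) \<le> B \<and> 0 < index y - index (T y)" if "y \<in> Orb" for y
  proof -
    have t: "1 \<le> h (T y) - h y" "h (T y) - h y \<le> step"
      using height_translation that unfolding T_def by auto
    have "index y - index (T y) \<le> ball_card (2 + C) * (h (T y) - h y + 1)"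
      using index_upper[of y "T y"] t by simp
    also have "\<dots> \<le> ball_card (2 + C) * (step + 1)"
      using t by (intro mult_left_mono) auto
    finally have "index y - index (T y) \<le> B" unfolding B_def by linarith
    moreover have "0 < (h (T y) - h y) / step" using t step_ge_1 by simp
    then have "0 < index y - index (T y)" using index_lower[OF that, of "T y"] t by linarith
    ultimately show ?thesis by blast
  qed note T = this
  have "T (T' y) = y" for y
    unfolding T_def T'_def using translation_in_carrier by (simp add: act_inv)
  then have T': "index (T' y) - index y \<le> B \<and> 0 < index (T' y) - index y" if "y \<in> Orb" for y
    using T[OF Orb(2)[OF that]] by simp
  \<comment> \<open>The sign \<open>s\<close> lets one argument serve both directions.\<close>
  have hit: "\<exists>y\<in>Orb. \<bar>s * index y - m\<bar> \<le> B"
    if m: "0 \<le> m" and f: "\<And>y. y \<in> Orb \<Longrightarrow> f y \<in> Orb"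
      and inc: "\<And>y. y \<in> Orb \<Longrightarrow> s * index (f y) - s * index y \<le> B \<and> 0 < s * index (f y) - s * index y"
    for m s f
  proof -
    have in_Orb: "(f ^^ i) x\<^sub>0 \<in> Orb" for i
      by (induction i) (auto simp: base_in_Orb f)
    have "int i \<le> s * index ((f ^^ i) x\<^sub>0)" for i
    proof (induction i)
      case 0 show ?case by (simp add: index_def)
    next
      case (Suc i) then show ?case using inc[OF in_Orb[of i]] by simp
    qed
    from this[of "nat m"] have "\<exists>i. m \<le> s * index ((f ^^ i) x\<^sub>0)" using m by auto
    moreover have "s * index ((f ^^ Suc i) x\<^sub>0) \<le> s * index ((f ^^ i) x\<^sub>0) + B" for i
      using inc[OF in_Orb[of i]] by simp
    moreover have "s * index ((f ^^ 0) x\<^sub>0) \<le> m" using m by (simp add: index_def)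
    ultimately obtain i where "\<bar>s * index ((f ^^ i) x\<^sub>0) - m\<bar> \<le> B"
      using int_sequence_hits_coarsely[of "\<lambda>i. s * index ((f ^^ i) x\<^sub>0)" m B] B by blast
    then show ?thesis using in_Orb by blast
  qed
  have "\<exists>y\<in>Orb. \<bar>index y - n\<bar> \<le> B" for n
  proof (cases "0 \<le> n")
    case True
    then show ?thesis using hit[of n T' 1] Orb T' by simp
  next
    case False
    then obtain y where "y \<in> Orb" "\<bar>- 1 * index y - (- n)\<bar> \<le> B"
      using hit[of "-n" T "-1"] Orb T by auto
    then show ?thesis by (intro bexI[of _ y]) auto
  qed
  then show ?thesis using B by blast
qed

section \<open>The coarsely equivariant embedding\<close>

lemma line_embedding_exists:
  "\<exists>F :: real \<Rightarrow> 'x. coarse_equivariant G (\<lambda>g. line_realization (line_action g)) \<phi> F \<and>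
     quasi_isometric_embedding F"
proof -
  obtain B where B: "0 \<le> B" "\<And>n. \<exists>y\<in>Orb. \<bar>index y - n\<bar> \<le> B"
    using index_coarsely_surjective by blast
  then obtain F\<^sub>0 where F\<^sub>0: "\<And>n. F\<^sub>0 n \<in> Orb" "\<And>n. \<bar>index (F\<^sub>0 n) - n\<bar> \<le> B"
    by metis
  \<comment> \<open>\<open>F\<close> is a coarse inverse of \<open>index\<close>; rounding to an
    integer adds 1 to the error \<open>B\<close>.\<close>
  define F where "F t = F\<^sub>0 \<lfloor>t\<rfloor>" for t :: real
  have F: "F t \<in> Orb" "\<bar>index (F t) - t\<bar> \<le> B + 1" for t :: real
  proof -
    have "\<bar>index (F t) - \<lfloor>t\<rfloor>\<bar> \<le> B" using F\<^sub>0(2) unfolding F_def by blast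
    then show "\<bar>index (F t) - t\<bar> \<le> B + 1" by linarith
    show "F t \<in> Orb" using F\<^sub>0(1) unfolding F_def by blast
  qed
  define N where "N = real (ball_card (17 * C))"
  have "dist (F (line_realization (line_action g) t)) (\<phi> g (F t)) \<le> step * (2 * (B + 1) + N) + C"
    if g: "g \<in> carrier G" for g and t :: real
  proof -
    let ?t = "line_realization (line_action g) t"
    have t: "?t = orientation g * t + shift g"
      by (simp add: line_realization_line_action)
    have "real_of_int \<bar>index (\<phi> g (F t)) - line_action g (index (F t))\<bar> \<le> N"
      using index_equivariant[OF g F(1)] unfolding N_def by (metis of_int_le_iff of_int_of_nat_eq)
    \<comment> \<open>The same affine map, of slope 1 or -1, is applied to
      \<open>index (F t)\<close> and to \<open>t\<close>.\<close>
    moreover have "\<bar>line_action g (index (F t)) - ?t\<bar> = \<bar>index (F t) - t\<bar>"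
      unfolding t line_action_def using orientation_cases[of g] by auto
    ultimately have "real_of_int \<bar>index (F ?t) - index (\<phi> g (F t))\<bar> \<le> 2 * (B + 1) + N"
      using F(2)[of t] F(2)[of ?t] by simp
    then have "step * real_of_int \<bar>index (F ?t) - index (\<phi> g (F t))\<bar> \<le> step * (2 * (B + 1) + N)"
      using step_ge_1 by (intro mult_left_mono) auto
    then show ?thesis
      using index_bounds(1)[OF F(1) Orb_closed[OF g F(1)], of ?t t] by linarith
  qed
  moreover have "0 \<le> step * (2 * (B + 1) + N) + C"
    using step_ge_1 B(1) C_nonneg unfolding N_def by simp
  ultimately have "coarse_equivariant G (\<lambda>g. line_realization (line_action g)) \<phi> F"
    unfolding coarse_equivariant_def by blast
  moreover have "quasi_isometric_embedding F"
  proof -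
    define M where "M = real (ball_card (2 + C))"
    define E where "E = real_of_int (2 * (B + 1))"
    define K where "K = max step M"
    have E: "0 \<le> E" using B(1) by (simp add: E_def)
    have M: "1 \<le> M" using ball_card_pos[of "2 + C"] C_nonneg by (simp add: M_def)
    have K: "1 \<le> K" "M \<le> K" "step \<le> K" using M by (auto simp: K_def)
    \<comment> \<open>The upper inequality needs \<open>K * E + C\<close> and the lower one
      \<open>C + 1 + E\<close>, where \<open>E\<close> is the total index error at the two
      ends.\<close>
    define A where "A = K * E + C + 1 + E"
    have KE: "0 \<le> K * E" using K E by simp
    have "dist s t / K - A \<le> dist (F s) (F t) \<and> dist (F s) (F t) \<le> K * dist s t + A" for s t :: real
    proof
      define d where "d = dist (F s) (F t)"
      define i where "i = real_of_int \<bar>index (F s) - index (F t)\<bar>"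
      have i: "i \<le> dist s t + E" "dist s t \<le> i + E"
        using F(2)[of s] F(2)[of t] unfolding i_def E_def dist_real_def by auto
      have "d \<le> step * i + C" "i \<le> M * (d + C + 1)"
        using index_bounds[OF F(1) F(1)] unfolding d_def i_def M_def by blast+
      moreover have "step * i \<le> K * (dist s t + E)"
        using i(1) K by (intro mult_mono) (auto simp: i_def)
      moreover have "M * (d + C + 1) \<le> K * (d + C + 1)"
        using K C_nonneg by (intro mult_right_mono) (auto simp: d_def)
      moreover have "E \<le> K * E" using K E by (simp add: mult_le_cancel_right1)
      ultimately have "d \<le> K * dist s t + K * E + C" "dist s t \<le> K * (d + C + 1 + E)"
        using i(2) by (simp_all add: algebra_simps)
      then have "d \<le> K * dist s t + A" "dist s t / K \<le> d + C + 1 + E"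
        using E K by (simp_all add: A_def divide_le_eq mult.commute)
      then show "dist s t / K - A \<le> d" "d \<le> K * dist s t + A"
        using KE by (simp_all add: A_def)
    qed
    moreover have "0 \<le> A" using KE E C_nonneg by (simp add: A_def)
    ultimately show ?thesis
      unfolding quasi_isometric_embedding_def using K(1) by blast
  qed
  ultimately show ?thesis by blast
qed

end

theorem corollary4p3:
  fixes G :: "('g, 'm) monoid_scheme"
    and \<phi> :: "'g \<Rightarrow> 'x \<Rightarrow> 'x::metric_space"
    and \<delta> :: real
    and p x :: 'x
  assumes "geodesic_space TYPE('x)"
    and "hyperbolic_space \<delta> TYPE('x)"
    and "isometric_action G \<phi>"
    and "card (limit_set p G \<phi> x) = 2"
    and "has_locally_finite_orbit G \<phi>"
  shows "\<exists>\<psi> :: 'g \<Rightarrow> int \<Rightarrow> int.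
           group_action G UNIV \<psi> \<and>
           (\<forall>g\<in>carrier G. line_automorphism (\<psi> g)) \<and>
           (\<exists>F :: real \<Rightarrow> 'x.
              coarse_equivariant G (\<lambda>g. line_realization (\<psi> g)) \<phi> F \<and>
              quasi_isometric_embedding F)"
proof -
  interpret four_point_space p "3 * \<delta>"
    by unfold_locales (rule gromov_product_hyperbolic[OF assms(1,2)])
  \<comment> \<open>This point may differ from the \<open>x\<close> whose orbit defines the limit
    set; the height function is available on either orbit.\<close>
  obtain x\<^sub>0 where x\<^sub>0: "\<And>R. R \<ge> 0 \<Longrightarrow> finite {y \<in> orbit G \<phi> x\<^sub>0. dist y x\<^sub>0 \<le> R}"
    using assms(5) unfolding has_locally_finite_orbit_def by blast
  have finite_ball: "finite {y \<in> orbit G \<phi> x\<^sub>0. dist y x\<^sub>0 \<le> R}" for R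
    by (rule finite_subset[OF _ x\<^sub>0[of "max R 0"]]) auto
  obtain h C where h: "\<And>y z. y \<in> orbit G \<phi> x\<^sub>0 \<Longrightarrow> z \<in> orbit G \<phi> x\<^sub>0 \<Longrightarrow> \<bar>\<bar>h y - h z\<bar> - dist y z\<bar> \<le> C"
    using height_function_exists[OF assms(3,4), of x\<^sub>0] by blast
  interpret coarse_line_action G \<phi> x\<^sub>0 h C
    by (rule coarse_line_action.intro)
      (fact isometric_actionD(1)[OF assms(3)] isometric_actionD(2)[OF assms(3)] finite_ball h
        orbit_unbounded[OF assms(3,4)])+
  show ?thesis
    using group_action_line_action line_automorphism_line_action line_embedding_exists by blast
qed

end
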